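(* Let $(M,\phi,\xi,\eta,g)$ be a $3$-dimensional $(\kappa,\mu,\nu)$-contact metric manifold with $\kappa<1$, and let $F$ be its $\phi$-sectional curvature. Then its Riemann curvature tensor can be written as $$R=F R_1+(F-\kappa)R_3+\mu R_4+\nu R_7,$$ where, for all vector fields $X,Y,Z$ on $M$, $$R_1(X,Y)Z=g(Y,Z)X-g(X,Z)Y,$$ $$R_3(X,Y)Z=\eta(X)\eta(Z)Y-\eta(Y)\eta(Z)X+g(X,Z)\eta(Y)\xi-g(Y,Z)\eta(X)\xi,$$ $$R_4(X,Y)Z=g(Y,Z)hX-g(X,Z)hY+g(hY,Z)X-g(hX,Z)Y,$$ $$R_7(X,Y)Z=g(Y,Z)\phi hX-g(X,Z)\phi hY+g(\phi hY,Z)X-g(\phi hX,Z)Y.$$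
   Context: An almost contact metric manifold $(M,\phi,\xi,\eta,g)$ is an odd-dimensional Riemannian manifold $(M,g)$ with a $(1,1)$-tensor field $\phi$, a vector field $\xi$ and a $1$-form $\eta$ such that $\eta(\xi)=1$, $\phi^2X=-X+\eta(X)\xi$ and $g(\phi X,\phi Y)=g(X,Y)-\eta(X)\eta(Y)$ for all vector fields $X,Y$. It is a contact metric manifold if $d\eta=\Phi$, where $\Phi(X,Y)=g(X,\phi Y)$; the convention is $d\eta(X,Y)=\frac12\left(X\eta(Y)-Y\eta(X)-\eta([X,Y])\right)$, so that $\nabla_X\xi=-\phi X-\phi hX$ holds on a contact metric manifold. Here $h=\frac12 L_\xi\phi$, with $L$ the Lie derivative. Curvature convention: $R(X,Y)Z=\nabla_X\nabla_YZ-\nabla_Y\nabla_XZ-\nabla_{[X,Y]}Z$ and $R(X,Y,Z,W)=g(R(X,Y)Z,W)$. A $(\kappa,\mu,\nu)$-contact metric manifold is a contact metric manifold for which there are smooth functions $\kappa,\mu,\nu$ on $M$ such that, for all vector fields $X,Y$, $$R(X,Y)\xi=\kappa\{\eta(Y)X-\eta(X)Y\}+\mu\{\eta(Y)hX-\eta(X)hY\}+\nu\{\eta(Y)\phi hX-\eta(X)\phi hY\}.$$ For a unit vector $X\in T_pM$ orthogonal to $\xi_p$, the $\phi$-sectional curvature of the plane spanned by $X,\phi X$ is $K(X,\phi X)=R(X,\phi X,\phi X,X)$. In dimension $3$ this does not depend on the choice of $X$ at $p$, and $F$ denotes the resulting function on $M$. *)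

theory Defs
  imports "HOL-Analysis.Analysis" "HOL-Library.Function_Algebras"
begin

text \<open>
  Pointwise scalar multiplication; together with the pointwise operations of
  \<^theory>\<open>HOL-Library.Function_Algebras\<close> it makes smooth functions, tangent vectors and vector
  fields (all of them functions with values in a real vector space) members of
  \<^class>\<open>real_vector\<close>.
\<close>

instantiation "fun" :: (type, scaleR) scaleR
begin

definition scaleR_fun_def: "a *\<^sub>R f = (\<lambda>x. a *\<^sub>R f x)"

instance ..

end

lemma scaleR_fun_apply [simp]: "(a *\<^sub>R f) x = a *\<^sub>R f x"
  by (simp add: scaleR_fun_def)

instance "fun" :: (type, real_vector) real_vector
  by standard (simp_all add: fun_eq_iff scaleR_add_right scaleR_add_left)


section \<open>Smooth manifolds\<close>

text \<open>
  Both notions below are meant for open \<open>S\<close> only. In the recursion, all directional derivatives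
  of a \<open>C\<^sup>k\<^sup>+\<^sup>1\<close> map are required to be \<open>C\<^sup>k\<close>.
\<close>

fun Ck_on :: "nat \<Rightarrow> 'b::euclidean_space set \<Rightarrow> ('b \<Rightarrow> 'c::real_normed_vector) \<Rightarrow> bool" where
  "Ck_on 0 S f \<longleftrightarrow> continuous_on S f"
| "Ck_on (Suc k) S f \<longleftrightarrow> (\<forall>x\<in>S. f differentiable (at x)) \<and>
     (\<forall>v. Ck_on k S (\<lambda>x. frechet_derivative f (at x) v))"

definition smooth_on :: "'b::euclidean_space set \<Rightarrow> ('b \<Rightarrow> 'c::real_normed_vector) \<Rightarrow> bool" where
  "smooth_on S f \<longleftrightarrow> (\<forall>k. Ck_on k S f)"

text \<open>
  A chart is a pair of its domain and its coordinate map. The values of the map off the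
  domain are irrelevant.
\<close>

type_synonym ('a, 'b) chart = "'a set \<times> ('a \<Rightarrow> 'b)"

text \<open>
  The manifold is the whole type \<open>'a\<close>, so that the Hausdorff property and second countability are
  expressed by its sort. Its dimension is \<open>DIM('b)\<close>. The atlas need not be maximal.
\<close>

locale smooth_manifold =
  fixes atlas :: "('a::{t2_space, second_countable_topology}, 'b::euclidean_space) chart set"
  assumes chart_homeomorphism:
      "(U, c) \<in> atlas \<Longrightarrow> open U \<and> open (c ` U) \<and> homeomorphism U (c ` U) c (inv_into U c)"
    and charts_cover: "(\<Union>(U, c)\<in>atlas. U) = UNIV"
    and charts_compatible:
      "(U, c) \<in> atlas \<Longrightarrow> (V, d) \<in> atlas \<Longrightarrow> smooth_on (c ` (U \<inter> V)) (d \<circ> inv_into U c)"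

definition smooth_functions ::
  "('a::topological_space, 'b::euclidean_space) chart set \<Rightarrow> ('a \<Rightarrow> real) set" where
  "smooth_functions atlas = {f. \<forall>(U, c)\<in>atlas. smooth_on (c ` U) (f \<circ> inv_into U c)}"


section \<open>Tangent vectors, vector fields, tensor fields\<close>

text \<open>
  Tangent vectors at \<open>p\<close> are the derivations at \<open>p\<close> of the algebra of smooth functions. They are
  set to \<open>0\<close> on functions that are not smooth, in order that equality of derivations be equality
  in HOL.
\<close>

type_synonym 'a tangent_vector = "('a \<Rightarrow> real) \<Rightarrow> real"
type_synonym 'a vector_field = "'a \<Rightarrow> 'a tangent_vector"

definition tangent_space ::
  "('a::topological_space, 'b::euclidean_space) chart set \<Rightarrow> 'a \<Rightarrow> 'a tangent_vector set" where
  "tangent_space atlas p = {v.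
     (\<forall>f\<in>smooth_functions atlas. \<forall>g\<in>smooth_functions atlas.
        v (f + g) = v f + v g \<and> v (f * g) = f p * v g + g p * v f) \<and>
     (\<forall>a. \<forall>f\<in>smooth_functions atlas. v (a *\<^sub>R f) = a * v f) \<and>
     (\<forall>f. f \<notin> smooth_functions atlas \<longrightarrow> v f = 0)}"

definition vector_fields ::
  "('a::topological_space, 'b::euclidean_space) chart set \<Rightarrow> 'a vector_field set" where
  "vector_fields atlas = {X. (\<forall>p. X p \<in> tangent_space atlas p) \<and>
     (\<forall>f\<in>smooth_functions atlas. (\<lambda>p. X p f) \<in> smooth_functions atlas)}"

definition field_scale :: "('a \<Rightarrow> real) \<Rightarrow> 'a vector_field \<Rightarrow> 'a vector_field" (infixr "\<odot>" 75)
  where "f \<odot> X = (\<lambda>p. f p *\<^sub>R X p)"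

definition field_deriv :: "'a vector_field \<Rightarrow> ('a \<Rightarrow> real) \<Rightarrow> 'a \<Rightarrow> real" where
  "field_deriv X f = (\<lambda>p. X p f)"

definition lie_bracket :: "'a vector_field \<Rightarrow> 'a vector_field \<Rightarrow> 'a vector_field" where
  "lie_bracket X Y = (\<lambda>p f. X p (field_deriv Y f) - Y p (field_deriv X f))"

text \<open>
  Tensor fields are families of (multi)linear maps on the tangent spaces. They act on vector
  fields pointwise: \<open>app1\<close> yields \<open>\<eta>(X)\<close> and \<open>\<phi>X\<close>, and \<open>app2\<close> yields \<open>g(X,Y)\<close>. Such a family is
  smooth iff it takes smooth vector fields to smooth objects.
\<close>

definition app1 :: "('a \<Rightarrow> 'a tangent_vector \<Rightarrow> 'c) \<Rightarrow> 'a vector_field \<Rightarrow> 'a \<Rightarrow> 'c" where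
  "app1 T X = (\<lambda>p. T p (X p))"

definition app2 :: "('a \<Rightarrow> 'a tangent_vector \<Rightarrow> 'a tangent_vector \<Rightarrow> 'c) \<Rightarrow>
    'a vector_field \<Rightarrow> 'a vector_field \<Rightarrow> 'a \<Rightarrow> 'c" where
  "app2 T X Y = (\<lambda>p. T p (X p) (Y p))"

definition linear_between ::
  "'u::real_vector set \<Rightarrow> 'v::real_vector set \<Rightarrow> ('u \<Rightarrow> 'v) \<Rightarrow> bool" where
  "linear_between S T L \<longleftrightarrow> (\<forall>u\<in>S. L u \<in> T) \<and> (\<forall>u\<in>S. \<forall>v\<in>S. L (u + v) = L u + L v) \<and>
     (\<forall>a. \<forall>u\<in>S. L (a *\<^sub>R u) = a *\<^sub>R L u)"

definition one_form :: "('a::topological_space, 'b::euclidean_space) chart set \<Rightarrow>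
    ('a \<Rightarrow> 'a tangent_vector \<Rightarrow> real) \<Rightarrow> bool" where
  "one_form atlas \<eta> \<longleftrightarrow> (\<forall>p. linear_between (tangent_space atlas p) UNIV (\<eta> p)) \<and>
     (\<forall>X\<in>vector_fields atlas. app1 \<eta> X \<in> smooth_functions atlas)"

definition endomorphism_field :: "('a::topological_space, 'b::euclidean_space) chart set \<Rightarrow>
    ('a \<Rightarrow> 'a tangent_vector \<Rightarrow> 'a tangent_vector) \<Rightarrow> bool" where
  "endomorphism_field atlas \<phi> \<longleftrightarrow>
     (\<forall>p. linear_between (tangent_space atlas p) (tangent_space atlas p) (\<phi> p)) \<and>
     (\<forall>X\<in>vector_fields atlas. app1 \<phi> X \<in> vector_fields atlas)"

text \<open>The convention with the factor \<open>1/2\<close>.\<close>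

definition ext_deriv :: "('a \<Rightarrow> 'a tangent_vector \<Rightarrow> real) \<Rightarrow>
    'a vector_field \<Rightarrow> 'a vector_field \<Rightarrow> 'a \<Rightarrow> real" where
  "ext_deriv \<eta> X Y = (1/2) *\<^sub>R
     (field_deriv X (app1 \<eta> Y) - field_deriv Y (app1 \<eta> X) - app1 \<eta> (lie_bracket X Y))"

definition lie_deriv_endo :: "'a vector_field \<Rightarrow> ('a \<Rightarrow> 'a tangent_vector \<Rightarrow> 'a tangent_vector) \<Rightarrow>
    'a vector_field \<Rightarrow> 'a vector_field" where
  "lie_deriv_endo V \<phi> X = lie_bracket V (app1 \<phi> X) - app1 \<phi> (lie_bracket V X)"


section \<open>Riemannian metrics, Levi-Civita connections, curvature\<close>

locale riemannian_manifold = smooth_manifold atlas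
  for atlas :: "('a::{t2_space, second_countable_topology}, 'b::euclidean_space) chart set" +
  fixes g :: "'a \<Rightarrow> 'a tangent_vector \<Rightarrow> 'a tangent_vector \<Rightarrow> real"
  assumes metric_linear:
      "u \<in> tangent_space atlas p \<Longrightarrow> linear_between (tangent_space atlas p) UNIV (g p u)"
    and metric_sym: "u \<in> tangent_space atlas p \<Longrightarrow> v \<in> tangent_space atlas p \<Longrightarrow> g p u v = g p v u"
    and metric_pos: "u \<in> tangent_space atlas p \<Longrightarrow> u \<noteq> 0 \<Longrightarrow> g p u u > 0"
    and metric_smooth: "X \<in> vector_fields atlas \<Longrightarrow> Y \<in> vector_fields atlas \<Longrightarrow>
      app2 g X Y \<in> smooth_functions atlas"

locale levi_civita = riemannian_manifold atlas g
  for atlas :: "('a::{t2_space, second_countable_topology}, 'b::euclidean_space) chart set"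
    and g :: "'a \<Rightarrow> 'a tangent_vector \<Rightarrow> 'a tangent_vector \<Rightarrow> real" +
  fixes D :: "'a vector_field \<Rightarrow> 'a vector_field \<Rightarrow> 'a vector_field"
  assumes conn_field: "X \<in> vector_fields atlas \<Longrightarrow> Y \<in> vector_fields atlas \<Longrightarrow>
      D X Y \<in> vector_fields atlas"
    and conn_add_left: "X \<in> vector_fields atlas \<Longrightarrow> Y \<in> vector_fields atlas \<Longrightarrow>
      Z \<in> vector_fields atlas \<Longrightarrow> D (X + Y) Z = D X Z + D Y Z"
    and conn_scale_left: "f \<in> smooth_functions atlas \<Longrightarrow> X \<in> vector_fields atlas \<Longrightarrow>
      Y \<in> vector_fields atlas \<Longrightarrow> D (f \<odot> X) Y = f \<odot> D X Y"
    and conn_add_right: "X \<in> vector_fields atlas \<Longrightarrow> Y \<in> vector_fields atlas \<Longrightarrow>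
      Z \<in> vector_fields atlas \<Longrightarrow> D X (Y + Z) = D X Y + D X Z"
    and conn_leibniz: "f \<in> smooth_functions atlas \<Longrightarrow> X \<in> vector_fields atlas \<Longrightarrow>
      Y \<in> vector_fields atlas \<Longrightarrow> D X (f \<odot> Y) = field_deriv X f \<odot> Y + f \<odot> D X Y"
    and torsion_free: "X \<in> vector_fields atlas \<Longrightarrow> Y \<in> vector_fields atlas \<Longrightarrow>
      D X Y - D Y X = lie_bracket X Y"
    and metric_compatible: "X \<in> vector_fields atlas \<Longrightarrow> Y \<in> vector_fields atlas \<Longrightarrow>
      Z \<in> vector_fields atlas \<Longrightarrow>
      field_deriv X (app2 g Y Z) = app2 g (D X Y) Z + app2 g Y (D X Z)"

definition curvature :: "('a vector_field \<Rightarrow> 'a vector_field \<Rightarrow> 'a vector_field) \<Rightarrow>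
    'a vector_field \<Rightarrow> 'a vector_field \<Rightarrow> 'a vector_field \<Rightarrow> 'a vector_field" where
  "curvature D X Y Z = D X (D Y Z) - D Y (D X Z) - D (lie_bracket X Y) Z"

text \<open>
  The curvature tensor on tangent vectors at \<open>p\<close>: the common value at \<open>p\<close> of \<open>R(X,Y)Z\<close> for all
  vector fields that extend the given tangent vectors.
\<close>

definition curvature_at :: "('a::topological_space, 'b::euclidean_space) chart set \<Rightarrow>
    ('a vector_field \<Rightarrow> 'a vector_field \<Rightarrow> 'a vector_field) \<Rightarrow> 'a \<Rightarrow>
    'a tangent_vector \<Rightarrow> 'a tangent_vector \<Rightarrow> 'a tangent_vector \<Rightarrow> 'a tangent_vector" where
  "curvature_at atlas D p u v w = (THE z. \<forall>X\<in>vector_fields atlas. \<forall>Y\<in>vector_fields atlas.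
     \<forall>Z\<in>vector_fields atlas. X p = u \<and> Y p = v \<and> Z p = w \<longrightarrow> curvature D X Y Z p = z)"


section \<open>Contact metric manifolds\<close>

locale almost_contact_metric_manifold = riemannian_manifold atlas g
  for atlas :: "('a::{t2_space, second_countable_topology}, 'b::euclidean_space) chart set"
    and g :: "'a \<Rightarrow> 'a tangent_vector \<Rightarrow> 'a tangent_vector \<Rightarrow> real" +
  fixes \<phi> :: "'a \<Rightarrow> 'a tangent_vector \<Rightarrow> 'a tangent_vector"
    and \<xi> :: "'a vector_field"
    and \<eta> :: "'a \<Rightarrow> 'a tangent_vector \<Rightarrow> real"
  assumes odd_dim: "odd (DIM('b))"
    and phi_endomorphism: "endomorphism_field atlas \<phi>"
    and xi_field: "\<xi> \<in> vector_fields atlas"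
    and eta_form: "one_form atlas \<eta>"
    and eta_xi: "app1 \<eta> \<xi> = 1"
    and phi_phi: "X \<in> vector_fields atlas \<Longrightarrow> app1 \<phi> (app1 \<phi> X) = - X + app1 \<eta> X \<odot> \<xi>"
    and metric_phi: "X \<in> vector_fields atlas \<Longrightarrow> Y \<in> vector_fields atlas \<Longrightarrow>
      app2 g (app1 \<phi> X) (app1 \<phi> Y) = app2 g X Y - app1 \<eta> X * app1 \<eta> Y"

locale contact_metric_manifold = almost_contact_metric_manifold atlas g \<phi> \<xi> \<eta>
  for atlas :: "('a::{t2_space, second_countable_topology}, 'b::euclidean_space) chart set"
    and g :: "'a \<Rightarrow> 'a tangent_vector \<Rightarrow> 'a tangent_vector \<Rightarrow> real"
    and \<phi> :: "'a \<Rightarrow> 'a tangent_vector \<Rightarrow> 'a tangent_vector"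
    and \<xi> :: "'a vector_field"
    and \<eta> :: "'a \<Rightarrow> 'a tangent_vector \<Rightarrow> real" +
  assumes contact: "X \<in> vector_fields atlas \<Longrightarrow> Y \<in> vector_fields atlas \<Longrightarrow>
      ext_deriv \<eta> X Y = app2 g X (app1 \<phi> Y)"

definition h_field :: "('a \<Rightarrow> 'a tangent_vector \<Rightarrow> 'a tangent_vector) \<Rightarrow> 'a vector_field \<Rightarrow>
    'a vector_field \<Rightarrow> 'a vector_field" where
  "h_field \<phi> \<xi> X = (1/2) *\<^sub>R lie_deriv_endo \<xi> \<phi> X"

locale kmn_contact_metric_manifold =
  contact_metric_manifold atlas g \<phi> \<xi> \<eta> + levi_civita atlas g D
  for atlas :: "('a::{t2_space, second_countable_topology}, 'b::euclidean_space) chart set"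
    and g :: "'a \<Rightarrow> 'a tangent_vector \<Rightarrow> 'a tangent_vector \<Rightarrow> real"
    and \<phi> :: "'a \<Rightarrow> 'a tangent_vector \<Rightarrow> 'a tangent_vector"
    and \<xi> :: "'a vector_field"
    and \<eta> :: "'a \<Rightarrow> 'a tangent_vector \<Rightarrow> real"
    and D :: "'a vector_field \<Rightarrow> 'a vector_field \<Rightarrow> 'a vector_field" +
  fixes \<kappa> \<mu> \<nu> :: "'a \<Rightarrow> real"
  assumes kappa_smooth: "\<kappa> \<in> smooth_functions atlas"
    and mu_smooth: "\<mu> \<in> smooth_functions atlas"
    and nu_smooth: "\<nu> \<in> smooth_functions atlas"
    and curvature_xi: "X \<in> vector_fields atlas \<Longrightarrow> Y \<in> vector_fields atlas \<Longrightarrow>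
      curvature D X Y \<xi> =
        \<kappa> \<odot> (app1 \<eta> Y \<odot> X - app1 \<eta> X \<odot> Y) +
        \<mu> \<odot> (app1 \<eta> Y \<odot> h_field \<phi> \<xi> X - app1 \<eta> X \<odot> h_field \<phi> \<xi> Y) +
        \<nu> \<odot> (app1 \<eta> Y \<odot> app1 \<phi> (h_field \<phi> \<xi> X) - app1 \<eta> X \<odot> app1 \<phi> (h_field \<phi> \<xi> Y))"

text \<open>
  The common value of \<open>R(u,\<phi>u,\<phi>u,u)\<close> over all unit vectors \<open>u\<close> at \<open>p\<close> orthogonal to \<open>\<xi>\<close>.
  It exists in dimension \<open>3\<close>; in higher dimension the definition is of no use.
\<close>

definition phi_sectional_curvature ::
  "('a::topological_space, 'b::euclidean_space) chart set \<Rightarrow>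
   ('a \<Rightarrow> 'a tangent_vector \<Rightarrow> 'a tangent_vector \<Rightarrow> real) \<Rightarrow>
   ('a \<Rightarrow> 'a tangent_vector \<Rightarrow> 'a tangent_vector) \<Rightarrow> 'a vector_field \<Rightarrow>
   ('a vector_field \<Rightarrow> 'a vector_field \<Rightarrow> 'a vector_field) \<Rightarrow> 'a \<Rightarrow> real" where
  "phi_sectional_curvature atlas g \<phi> \<xi> D p =
     (THE c. \<forall>u\<in>tangent_space atlas p. g p u u = 1 \<and> g p u (\<xi> p) = 0 \<longrightarrow>
        g p (curvature_at atlas D p u (\<phi> p u) (\<phi> p u)) u = c)"


section \<open>The component tensors\<close>

definition R1 :: "('a \<Rightarrow> 'a tangent_vector \<Rightarrow> 'a tangent_vector \<Rightarrow> real) \<Rightarrow>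
    'a vector_field \<Rightarrow> 'a vector_field \<Rightarrow> 'a vector_field \<Rightarrow> 'a vector_field" where
  "R1 g X Y Z = app2 g Y Z \<odot> X - app2 g X Z \<odot> Y"

definition R3 :: "('a \<Rightarrow> 'a tangent_vector \<Rightarrow> 'a tangent_vector \<Rightarrow> real) \<Rightarrow>
    'a vector_field \<Rightarrow> ('a \<Rightarrow> 'a tangent_vector \<Rightarrow> real) \<Rightarrow>
    'a vector_field \<Rightarrow> 'a vector_field \<Rightarrow> 'a vector_field \<Rightarrow> 'a vector_field" where
  "R3 g \<xi> \<eta> X Y Z =
     (app1 \<eta> X * app1 \<eta> Z) \<odot> Y - (app1 \<eta> Y * app1 \<eta> Z) \<odot> X +
     (app2 g X Z * app1 \<eta> Y) \<odot> \<xi> - (app2 g Y Z * app1 \<eta> X) \<odot> \<xi>"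

definition R4 :: "('a \<Rightarrow> 'a tangent_vector \<Rightarrow> 'a tangent_vector \<Rightarrow> real) \<Rightarrow>
    ('a \<Rightarrow> 'a tangent_vector \<Rightarrow> 'a tangent_vector) \<Rightarrow> 'a vector_field \<Rightarrow>
    'a vector_field \<Rightarrow> 'a vector_field \<Rightarrow> 'a vector_field \<Rightarrow> 'a vector_field" where
  "R4 g \<phi> \<xi> X Y Z =
     app2 g Y Z \<odot> h_field \<phi> \<xi> X - app2 g X Z \<odot> h_field \<phi> \<xi> Y +
     app2 g (h_field \<phi> \<xi> Y) Z \<odot> X - app2 g (h_field \<phi> \<xi> X) Z \<odot> Y"

definition R7 :: "('a \<Rightarrow> 'a tangent_vector \<Rightarrow> 'a tangent_vector \<Rightarrow> real) \<Rightarrow>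
    ('a \<Rightarrow> 'a tangent_vector \<Rightarrow> 'a tangent_vector) \<Rightarrow> 'a vector_field \<Rightarrow>
    'a vector_field \<Rightarrow> 'a vector_field \<Rightarrow> 'a vector_field \<Rightarrow> 'a vector_field" where
  "R7 g \<phi> \<xi> X Y Z =
     app2 g Y Z \<odot> app1 \<phi> (h_field \<phi> \<xi> X) - app2 g X Z \<odot> app1 \<phi> (h_field \<phi> \<xi> Y) +
     app2 g (app1 \<phi> (h_field \<phi> \<xi> Y)) Z \<odot> X - app2 g (app1 \<phi> (h_field \<phi> \<xi> X)) Z \<odot> Y"

end

theory Submission
  imports Defs
begin

text \<open>
  The pair symmetry of \<open>R(X,Y,Z,W)\<close> reduces everything to the given \<open>R(X,Y)\<xi>\<close> and to the
  restriction of \<open>R\<close> to \<open>ker \<eta>\<close>, which has a single component, the \<open>\<phi>\<close>-sectional curvature, because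
  \<open>ker \<eta>\<close> is a plane. The terms in \<open>\<mu>\<close> and \<open>\<nu>\<close> match because \<open>h\<close> anticommutes with \<open>\<phi>\<close>, so that
  \<open>h\<close> and \<open>\<phi>h\<close> are traceless on this plane. Pair symmetry also makes \<open>R\<close> tensorial without local
  frames: \<open>g(R(X,Y)Z,W)\<close> depends on \<open>W\<close> pointwise, hence on every argument.

  That derivations at a point form a space of dimension at most \<open>3\<close> comes from Hadamard's lemma and
  a bump function.
\<close>

subsection \<open>Maps of class \<open>C\<^sup>k\<close>\<close>

text \<open>The obstacle is the scarcity of vector fields: the proof bounds the tangent spaces from
  above but does not extend a tangent vector to a field, so only values of fields already at hand
  can be used. The operator \<open>h_field\<close>, built from Lie brackets, acts on fields; its
  values at a point have to come from linearity over smooth functions. This asks for an expansion in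
  \<xi>, E, \<phi>E with globally smooth coefficients. Since E may have zeros, the expansion is
  multiplied by g(E,E), and the division takes place only after evaluation at a point where E does
  not vanish. The definite descriptions behind \<open>curvature_at\<close> and
  \<open>phi_sectional_curvature\<close> are evaluated at such a point too: there every unit vector
  orthogonal to \<xi> is a combination of E and \<phi>E with constant coefficients, hence the value
  of a field. The final equality is tested against the difference of its two sides, with
  coefficients frozen at the point because smoothness of F is not known.\<close>

lemma has_derivative_frechet:
  "f differentiable (at x) \<Longrightarrow> (f has_derivative frechet_derivative f (at x)) (at x)"
  by (simp add: frechet_derivative_works)

text \<open>Derivatives are taken in full neighbourhoods, so agreement on \<open>S\<close> passes to
  them because \<open>S\<close> is open. This makes \<open>Ck_on\<close> blind to the values off
  \<open>S\<close>.\<close>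

lemma Ck_on_cong:
  assumes "open S" "\<And>x. x \<in> S \<Longrightarrow> f x = g x" "Ck_on k S f"
  shows "Ck_on k S g"
  using assms(2,3)
proof (induction k arbitrary: f g)
  case 0
  then show ?case by (simp cong: continuous_on_cong)
next
  case (Suc k)
  have der: "(g has_derivative frechet_derivative f (at x)) (at x)" if "x \<in> S" for x
    using Suc.prems that
    by (intro has_derivative_transform_within_open[OF has_derivative_frechet assms(1)]) auto
  have fr: "frechet_derivative f (at x) = frechet_derivative g (at x)" if "x \<in> S" for x
    using frechet_derivative_at[OF der[OF that]] .
  have "Ck_on k S (\<lambda>x. frechet_derivative g (at x) v)" for v
    by (rule Suc.IH[of "\<lambda>x. frechet_derivative f (at x) v"]) (use fr Suc.prems in auto)
  then show ?case using der by (auto simp: differentiable_def)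
qed

text \<open>Accepts any formula for the derivative, so that the inductions below need not compute
  \<open>frechet_derivative\<close> of compound maps.\<close>

lemma Ck_on_SucI:
  assumes "open S" "\<And>x. x \<in> S \<Longrightarrow> (f has_derivative f' x) (at x)"
    and "\<And>v. Ck_on k S (\<lambda>x. f' x v)"
  shows "Ck_on (Suc k) S f"
proof -
  have "Ck_on k S (\<lambda>x. frechet_derivative f (at x) v)" for v
    by (rule Ck_on_cong[OF assms(1) _ assms(3)[of v]]) (simp add: frechet_derivative_at[OF assms(2)])
  then show ?thesis using assms(2) by (auto simp: differentiable_def)
qed

lemma Ck_on_SucD:
  assumes "Ck_on (Suc k) S f"
  shows "Ck_on k S f"
  using assms
proof (induction k arbitrary: f)
  case 0
  then show ?case
    by (auto intro!: continuous_at_imp_continuous_on differentiable_imp_continuous_within)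
next
  case (Suc k)
  then show ?case by (metis Ck_on.simps(2))
qed

lemma Ck_on_imp_continuous_on: "Ck_on k S f \<Longrightarrow> continuous_on S f"
proof (induction k)
  case (Suc k)
  then show ?case using Ck_on_SucD by blast
qed simp

lemma Ck_on_subset: "Ck_on k S f \<Longrightarrow> T \<subseteq> S \<Longrightarrow> Ck_on k T f"
  by (induction k arbitrary: f) (auto intro: continuous_on_subset)

lemma Ck_on_Un:
  assumes "open S" "open T" "Ck_on k S f" "Ck_on k T f"
  shows "Ck_on k (S \<union> T) f"
  using assms(3,4) by (induction k arbitrary: f) (auto intro: continuous_on_open_Un assms(1,2))

lemma Ck_on_const: "Ck_on k S (\<lambda>_. c)"
  by (induction k arbitrary: c) auto

lemma Ck_on_bounded_linear:
  assumes "open S" "bounded_linear L" "Ck_on k S f"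
  shows "Ck_on k S (\<lambda>x. L (f x))"
  using assms(3)
proof (induction k arbitrary: f)
  case 0
  then show ?case using assms(2) by (simp add: bounded_linear.continuous_on)
next
  case (Suc k)
  show ?case
  proof (rule Ck_on_SucI[OF assms(1)])
    show "((\<lambda>x. L (f x)) has_derivative (\<lambda>v. L (frechet_derivative f (at x) v))) (at x)"
      if "x \<in> S" for x
      using Suc.prems that
      by (intro bounded_linear.has_derivative[OF assms(2)] has_derivative_frechet) auto
  qed (use Suc in auto)
qed

lemma Ck_on_add:
  assumes "open S" "Ck_on k S f" "Ck_on k S g"
  shows "Ck_on k S (\<lambda>x. f x + g x)"
  using assms(2,3)
proof (induction k arbitrary: f g)
  case 0
  then show ?case by (simp add: continuous_on_add)
next
  case (Suc k)
  show ?case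
  proof (rule Ck_on_SucI[OF assms(1)])
    show "((\<lambda>x. f x + g x) has_derivative
        (\<lambda>v. frechet_derivative f (at x) v + frechet_derivative g (at x) v)) (at x)"
      if "x \<in> S" for x
      using Suc.prems that by (intro has_derivative_add has_derivative_frechet) auto
  qed (use Suc in auto)
qed

lemma Ck_on_sum:
  assumes "open S" "\<And>i. i \<in> I \<Longrightarrow> Ck_on k S (f i)"
  shows "Ck_on k S (\<lambda>x. \<Sum>i\<in>I. f i x)"
  using assms(2)
  by (induction I rule: infinite_finite_induct)
     (auto intro: Ck_on_add[OF assms(1)] Ck_on_const)

lemma Ck_on_mult:
  fixes f g :: "'b::euclidean_space \<Rightarrow> real"
  assumes "open S" "Ck_on k S f" "Ck_on k S g"
  shows "Ck_on k S (\<lambda>x. f x * g x)"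
  using assms(2,3)
proof (induction k arbitrary: f g)
  case 0
  then show ?case by (simp add: continuous_on_mult)
next
  case (Suc k)
  show ?case
  proof (rule Ck_on_SucI[OF assms(1)])
    show "((\<lambda>x. f x * g x) has_derivative
        (\<lambda>v. f x * frechet_derivative g (at x) v + frechet_derivative f (at x) v * g x)) (at x)"
      if "x \<in> S" for x
      using Suc.prems that by (intro has_derivative_mult has_derivative_frechet) simp_all
    show "Ck_on k S
        (\<lambda>x. f x * frechet_derivative g (at x) v + frechet_derivative f (at x) v * g x)" for v
      using Suc.prems Ck_on_SucD[OF Suc.prems(1)] Ck_on_SucD[OF Suc.prems(2)]
      by (intro Ck_on_add[OF assms(1)] Suc.IH) simp_all
  qed
qed

text \<open>In the chain rule the direction in which \<open>g\<close> is differentiated varies with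
  the point, whereas \<open>Ck_on\<close> speaks of fixed directions. Expanding it in
  \<open>Basis\<close> gives a sum of products to which the induction hypothesis for
  \<open>g\<close> applies.\<close>

lemma Ck_on_compose:
  fixes f :: "'b::euclidean_space \<Rightarrow> 'c::euclidean_space" and g :: "'c \<Rightarrow> real"
  assumes "open S" "f ` S \<subseteq> T" "Ck_on k S f" "Ck_on k T g"
  shows "Ck_on k S (\<lambda>x. g (f x))"
  using assms(3,4)
proof (induction k arbitrary: g)
  case 0
  then show ?case using continuous_on_compose2[of T g S f] assms(2) by simp
next
  case (Suc k)
  show ?case
  proof (rule Ck_on_SucI[OF assms(1)])
    fix x assume x: "x \<in> S"
    let ?f = "frechet_derivative f (at x)" and ?g = "frechet_derivative g (at (f x))"
    have f: "(f has_derivative ?f) (at x)" and g: "(g has_derivative ?g) (at (f x))"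
      using Suc.prems x subsetD[OF assms(2) imageI[OF x]]
      by (simp_all add: has_derivative_frechet)
    have rep: "?g w = (\<Sum>b\<in>Basis. (w \<bullet> b) * ?g b)" for w
    proof -
      have l: "linear ?g" using g has_derivative_linear by blast
      have "?g w = ?g (\<Sum>b\<in>Basis. (w \<bullet> b) *\<^sub>R b)" by (simp add: euclidean_representation)
      also have "\<dots> = (\<Sum>b\<in>Basis. (w \<bullet> b) * ?g b)"
        by (simp add: linear_sum[OF l] linear_scale[OF l])
      finally show ?thesis .
    qed
    have "((\<lambda>x. g (f x)) has_derivative (\<lambda>v. ?g (?f v))) (at x)"
      by (rule has_derivative_compose[OF f g])
    also have "(\<lambda>v. ?g (?f v)) = (\<lambda>v. \<Sum>b\<in>Basis. (?f v \<bullet> b) * ?g b)"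
      by (rule ext) (rule rep)
    finally show "((\<lambda>x. g (f x)) has_derivative \<dots>) (at x)" .
  next
    fix v
    have 1: "Ck_on k S (\<lambda>x. frechet_derivative f (at x) v \<bullet> b)" for b
      by (rule Ck_on_bounded_linear[OF assms(1) bounded_linear_inner_left]) (use Suc.prems(1) in simp)
    have 2: "Ck_on k S (\<lambda>x. frechet_derivative g (at (f x)) b)" for b
      by (rule Suc.IH[OF Ck_on_SucD[OF Suc.prems(1)]]) (use Suc.prems(2) in simp)
    show "Ck_on k S
        (\<lambda>x. \<Sum>b\<in>Basis. (frechet_derivative f (at x) v \<bullet> b) * frechet_derivative g (at (f x)) b)"
      by (rule Ck_on_sum[OF assms(1) Ck_on_mult[OF assms(1) 1 2]])
  qed
qed

lemma Ck_on_id: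
  assumes "open S" shows "Ck_on k S (\<lambda>x. x)"
proof (cases k)
  case (Suc j)
  show ?thesis unfolding Suc
    by (rule Ck_on_SucI[OF assms has_derivative_ident]) (rule Ck_on_const)
qed simp

subsection \<open>A bump function\<close>

text \<open>The case \<open>m = 0\<close> is the classical flat function. The negative powers of t
  are included so that the span of the family is closed under differentiation, and one induction on
  the order proves all members smooth.\<close>

definition flat_exp :: "nat \<Rightarrow> real \<Rightarrow> real" where
  "flat_exp m t = (if t > 0 then inverse t ^ m * exp (- inverse t) else 0)"

lemma flat_exp_tendsto_0: "(flat_exp m \<longlongrightarrow> 0) (at 0)"
proof -
  have "((\<lambda>t::real. inverse t ^ m / exp (inverse t)) \<longlongrightarrow> 0) (at_right 0)"
    by (rule filterlim_compose[OF tendsto_power_div_exp_0 filterlim_inverse_at_top_right])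
  then have "(flat_exp m \<longlongrightarrow> 0) (at_right 0)"
    by (rule Lim_transform_eventually)
       (auto simp: eventually_at_filter flat_exp_def exp_minus field_simps)
  moreover have "(flat_exp m \<longlongrightarrow> 0) (at_left 0)"
    by (rule Lim_transform_eventually[OF tendsto_const])
       (auto simp: eventually_at_filter flat_exp_def)
  ultimately show ?thesis
    by (simp add: filterlim_split_at)
qed

lemma flat_exp_has_derivative:
  "(flat_exp m has_real_derivative flat_exp (m + 2) t - real m * flat_exp (m + 1) t) (at t)"
proof -
  consider "t > 0" | "t < 0" | "t = 0" by linarith
  then show ?thesis
  proof cases
    case 1
    have "((\<lambda>t. inverse t ^ m * exp (- inverse t)) has_real_derivative
        flat_exp (m + 2) t - real m * flat_exp (m + 1) t) (at t)"
    proof -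
      have inv: "(inverse has_real_derivative - (inverse t ^ 2)) (at t)"
        using DERIV_inverse[of t] 1 by (simp add: numeral_2_eq_2)
      have "((\<lambda>t. inverse t ^ m) has_real_derivative
          real m * (- (inverse t ^ 2) * inverse t ^ (m - 1))) (at t)"
        using DERIV_power[OF inv, of m] by simp
      moreover have "((\<lambda>t. exp (- inverse t)) has_real_derivative
          exp (- inverse t) * inverse t ^ 2) (at t)"
        using DERIV_chain2[OF DERIV_exp DERIV_minus[OF inv]] by simp
      ultimately have "((\<lambda>t. inverse t ^ m * exp (- inverse t)) has_real_derivative
          real m * (- (inverse t ^ 2) * inverse t ^ (m - 1)) * exp (- inverse t) +
          exp (- inverse t) * inverse t ^ 2 * inverse t ^ m) (at t)"
        by (rule DERIV_mult)
      \<comment> \<open>For \<open>m = 0\<close> the exponent \<open>m - 1\<close> is truncated, but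
        the factor \<open>real m\<close> removes that term.\<close>
      also have "real m * (- (inverse t ^ 2) * inverse t ^ (m - 1)) * exp (- inverse t) +
          exp (- inverse t) * inverse t ^ 2 * inverse t ^ m =
          flat_exp (m + 2) t - real m * flat_exp (m + 1) t"
        using 1 by (cases m) (auto simp: flat_exp_def algebra_simps power2_eq_square)
      finally show ?thesis .
    qed
    then show ?thesis
      by (rule has_field_derivative_transform_within_open[where S = "{0<..}"])
         (use 1 in \<open>auto simp: flat_exp_def\<close>)
  next
    case 2
    have "((\<lambda>t. 0) has_real_derivative flat_exp (m + 2) t - real m * flat_exp (m + 1) t) (at t)"
      using 2 by (auto simp: flat_exp_def)
    then show ?thesis
      by (rule has_field_derivative_transform_within_open[where S = "{..<0}"])
         (use 2 in \<open>auto simp: flat_exp_def\<close>)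
  next
    case 3
    \<comment> \<open>The difference quotient at 0 is \<open>flat_exp (m + 1)\<close>, whose limit
      is known.\<close>
    have "((\<lambda>h. flat_exp m h / h) \<longlongrightarrow> 0) (at 0)"
      by (rule Lim_transform_eventually[OF flat_exp_tendsto_0[of "m + 1"]])
         (auto simp: eventually_at_filter flat_exp_def field_simps)
    then show ?thesis
      by (simp add: 3 DERIV_def flat_exp_def)
  qed
qed

lemma Ck_on_flat_exp: "Ck_on k UNIV (flat_exp m)"
proof (induction k arbitrary: m)
  case 0
  show ?case
    using DERIV_continuous_on[OF has_field_derivative_at_within[OF flat_exp_has_derivative]]
    by simp
next
  case (Suc k)
  show ?case
  proof (rule Ck_on_SucI)
    show "(flat_exp m has_derivative
        (\<lambda>v. v * (flat_exp (m + 2) t + (- real m) * flat_exp (m + 1) t))) (at t)" for t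
      using flat_exp_has_derivative[of m t]
      by (simp add: has_field_derivative_def mult_commute_abs)
    show "Ck_on k UNIV (\<lambda>t. v * (flat_exp (m + 2) t + (- real m) * flat_exp (m + 1) t))" for v
      by (intro Ck_on_mult Ck_on_add Ck_on_const Suc.IH open_UNIV)
  qed simp
qed

text \<open>The squared distance is written as an inner product, a polynomial in the coordinates.
  The function is not constant near \<open>a\<close>; positivity at \<open>a\<close> and vanishing
  off the ball are what matters later.\<close>

definition bump :: "real \<Rightarrow> 'b::euclidean_space \<Rightarrow> 'b \<Rightarrow> real" where
  "bump r a x = flat_exp 0 (r\<^sup>2 - (x - a) \<bullet> (x - a))"

lemma bump_center: "r > 0 \<Longrightarrow> bump r a a > 0"
  by (simp add: bump_def flat_exp_def)

lemma bump_support: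
  assumes "r > 0" "x \<notin> ball a r" shows "bump r a x = 0"
proof -
  have "r\<^sup>2 \<le> (norm (x - a))\<^sup>2"
    using assms by (intro power_mono) (auto simp: dist_norm norm_minus_commute)
  then show ?thesis by (simp add: bump_def flat_exp_def power2_norm_eq_inner)
qed

lemma Ck_on_bump:
  assumes "open S" shows "Ck_on k S (bump r a)"
proof -
  have diff: "Ck_on k S (\<lambda>x. (x + (- a)) \<bullet> b)" for b
    by (intro Ck_on_bounded_linear[OF assms bounded_linear_inner_left] Ck_on_add Ck_on_id
        Ck_on_const assms)
  have "Ck_on k S (\<lambda>x. r\<^sup>2 + (- 1) * (\<Sum>b\<in>Basis. ((x + (- a)) \<bullet> b) * ((x + (- a)) \<bullet> b)))"
    by (intro Ck_on_add Ck_on_mult Ck_on_sum Ck_on_const diff assms)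
  then have "Ck_on k S (\<lambda>x. flat_exp 0
      (r\<^sup>2 + (- 1) * (\<Sum>b\<in>Basis. ((x + (- a)) \<bullet> b) * ((x + (- a)) \<bullet> b))))"
    by (rule Ck_on_compose[OF assms subset_UNIV _ Ck_on_flat_exp])
  then show ?thesis
    by (rule Ck_on_cong[OF assms, rotated])
       (simp add: bump_def euclidean_inner[of "_ - a" "_ - a"])
qed

subsection \<open>Hadamard's lemma\<close>

text \<open>The cofactors in Hadamard's lemma have \<open>m = 0\<close>. Each derivative in
  \<open>x\<close> brings down a factor t from the inner map, so the weight \<open>t ^ m\<close>
  closes the family under differentiation.\<close>

definition ray_integral :: "nat \<Rightarrow> 'b::euclidean_space \<Rightarrow> ('b \<Rightarrow> real) \<Rightarrow> 'b \<Rightarrow> real" where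
  "ray_integral m a f x = integral (cbox 0 1) (\<lambda>t. t ^ m * f (a + t *\<^sub>R (x - a)))"

lemma ray_in_ball:
  fixes x :: "'b::euclidean_space"
  assumes "x \<in> ball a r" "t \<in> cbox 0 (1::real)"
  shows "a + t *\<^sub>R (x - a) \<in> ball a r"
proof -
  have "\<bar>t\<bar> * norm (x - a) \<le> 1 * norm (x - a)"
    using assms by (intro mult_right_mono) auto
  then show ?thesis using assms by (simp add: dist_norm norm_minus_commute)
qed

lemma continuous_on_ray:
  fixes f :: "'b::euclidean_space \<Rightarrow> real"
  assumes "continuous_on (ball a r) f"
  shows "continuous_on (ball a r \<times> cbox 0 1) (\<lambda>(x, t). t ^ m * f (a + t *\<^sub>R (x - a)))"
  unfolding split_beta
  by (intro continuous_intros continuous_on_compose2[OF assms]) (auto intro!: ray_in_ball)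

lemma continuous_on_ray_section:
  fixes f :: "'b::euclidean_space \<Rightarrow> real"
  assumes "continuous_on (ball a r) f" "x \<in> ball a r"
  shows "continuous_on (cbox 0 1) (\<lambda>t. t ^ m * f (a + t *\<^sub>R (x - a)))"
  by (intro continuous_intros continuous_on_compose2[OF assms(1)])
     (use assms(2) ray_in_ball in blast)

lemma ray_integral_has_derivative:
  fixes f :: "'b::euclidean_space \<Rightarrow> real"
  assumes f: "Ck_on (Suc 0) (ball a r) f" and x: "x \<in> ball a r"
  shows "(ray_integral m a f has_derivative
    (\<lambda>v. ray_integral (Suc m) a (\<lambda>y. frechet_derivative f (at y) v) x)) (at x)"
proof -
  let ?D = "\<lambda>y. frechet_derivative f (at y)"
  \<comment> \<open>\<open>leibniz_rule\<close> takes the derivative of the integrand as a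
    continuous family of bounded linear maps.\<close>
  define F where "F x t = Blinfun (\<lambda>v. t ^ Suc m * ?D (a + t *\<^sub>R (x - a)) v)" for x t
  have D: "(f has_derivative ?D y) (at y)" if "y \<in> ball a r" for y
    using f that by (auto intro: has_derivative_frechet)
  have F: "blinfun_apply (F x t) = (\<lambda>v. t ^ Suc m * ?D (a + t *\<^sub>R (x - a)) v)"
    if "x \<in> ball a r" "t \<in> cbox 0 1" for x t
    unfolding F_def using D[OF ray_in_ball[OF that]]
    by (intro bounded_linear_Blinfun_apply bounded_linear_mult_right[THEN bounded_linear_compose]
        has_derivative_bounded_linear)
  \<comment> \<open>In finite dimension this continuity can be tested on basis vectors, where it is
    continuity of directional derivatives.\<close>
  have cF: "continuous_on (ball a r \<times> cbox 0 1) (\<lambda>(x, t). F x t)"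
    unfolding continuous_on_eq_continuous_within
  proof (intro ballI continuous_blinfun_componentwiseI1)
    fix p :: "'b \<times> real" and b :: 'b
    assume p: "p \<in> ball a r \<times> cbox 0 1"
    have "continuous_on (ball a r \<times> cbox 0 1)
        (\<lambda>(x, t). t ^ Suc m * ?D (a + t *\<^sub>R (x - a)) b)"
      using f by (intro continuous_on_ray) auto
    then have "continuous_on (ball a r \<times> cbox 0 1) (\<lambda>z. blinfun_apply (case z of (x, t) \<Rightarrow> F x t) b)"
      by (rule continuous_on_eq) (auto simp: F simp del: mem_ball)
    then show "continuous (at p within ball a r \<times> cbox 0 1)
        (\<lambda>z. blinfun_apply (case z of (x, t) \<Rightarrow> F x t) b)"
      using p continuous_on_eq_continuous_within by blast
  qed
  have int: "(\<lambda>t. t ^ m * f (a + t *\<^sub>R (x - a))) integrable_on cbox 0 1" if "x \<in> ball a r" for x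
    by (intro integrable_continuous continuous_on_ray_section[OF Ck_on_imp_continuous_on[OF f] that])
  have der: "((\<lambda>x. t ^ m * f (a + t *\<^sub>R (x - a))) has_derivative blinfun_apply (F x t))
      (at x within ball a r)" if "x \<in> ball a r" "t \<in> cbox 0 1" for x t
  proof -
    have "((\<lambda>x. a + t *\<^sub>R (x - a)) has_derivative (\<lambda>v. t *\<^sub>R v)) (at x)"
      by (auto intro!: derivative_eq_intros)
    from has_derivative_compose[OF this D[OF ray_in_ball[OF that]]]
    have "((\<lambda>x. t ^ m * f (a + t *\<^sub>R (x - a))) has_derivative
        (\<lambda>v. t ^ m * ?D (a + t *\<^sub>R (x - a)) (t *\<^sub>R v))) (at x)"
      by (rule has_derivative_mult_right)
    also have "(\<lambda>v. t ^ m * ?D (a + t *\<^sub>R (x - a)) (t *\<^sub>R v)) = blinfun_apply (F x t)"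
      using has_derivative_linear[OF D[OF ray_in_ball[OF that]]]
      by (simp add: F[OF that] linear_scale mult.assoc mult.commute mult.left_commute)
    finally show ?thesis by (rule has_derivative_at_withinI)
  qed
  have "((\<lambda>x. integral (cbox 0 1) (\<lambda>t. t ^ m * f (a + t *\<^sub>R (x - a)))) has_derivative
      blinfun_apply (integral (cbox 0 1) (F x))) (at x within ball a r)"
    by (rule leibniz_rule[OF der int cF x]) auto
  moreover have "blinfun_apply (integral (cbox 0 1) (F x)) =
      (\<lambda>v. ray_integral (Suc m) a (\<lambda>y. ?D y v) x)"
  proof
    fix v
    have "F x integrable_on cbox 0 1"
      using continuous_on_compose2[OF cF, of "cbox 0 1" "\<lambda>t. (x, t)"] x
        continuous_on_Pair[OF continuous_on_const continuous_on_id, of "cbox 0 (1::real)" x]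
      by (intro integrable_continuous) (auto simp del: mem_ball)
    then have "((\<lambda>t. blinfun_apply (F x t) v) has_integral
        blinfun_apply (integral (cbox 0 1) (F x)) v) (cbox 0 1)"
      using has_integral_linear[OF integrable_integral blinfun.bounded_linear_left, of "F x" "cbox 0 1" v]
      by (simp add: o_def)
    then have "blinfun_apply (integral (cbox 0 1) (F x)) v =
        integral (cbox 0 1) (\<lambda>t. blinfun_apply (F x t) v)"
      by (simp add: integral_unique)
    also have "\<dots> = ray_integral (Suc m) a (\<lambda>y. ?D y v) x"
      unfolding ray_integral_def using x by (intro integral_cong) (simp add: F)
    finally show "blinfun_apply (integral (cbox 0 1) (F x)) v = \<dots>" .
  qed
  ultimately show ?thesis
    using x by (simp add: ray_integral_def[abs_def] at_within_open[OF x])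
qed

lemma Ck_on_ray_integral:
  fixes f :: "'b::euclidean_space \<Rightarrow> real"
  assumes "Ck_on k (ball a r) f"
  shows "Ck_on k (ball a r) (ray_integral m a f)"
  using assms
proof (induction k arbitrary: f m)
  case 0
  then show ?case
    using integral_continuous_on_param[OF continuous_on_ray, of a r f m]
    by (simp add: ray_integral_def[abs_def])
next
  case (Suc k)
  have "Ck_on (Suc 0) (ball a r) f"
    using Suc.prems by (auto intro: Ck_on_imp_continuous_on)
  then show ?case
    using Suc by (intro Ck_on_SucI[OF _ ray_integral_has_derivative]) auto
qed

text \<open>The fundamental theorem of calculus on the segment from \<open>a\<close> to
  \<open>x\<close>, which stays in the ball, with the derivative in direction \<open>x - a\<close>
  expanded in \<open>Basis\<close>.\<close>

lemma hadamard:
  fixes f :: "'b::euclidean_space \<Rightarrow> real"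
  assumes f: "Ck_on (Suc 0) (ball a r) f" and x: "x \<in> ball a r"
  shows "f x = f a + (\<Sum>b\<in>Basis. ((x - a) \<bullet> b) *
    ray_integral 0 a (\<lambda>y. frechet_derivative f (at y) b) x)"
proof -
  let ?D = "\<lambda>y. frechet_derivative f (at y)" and ?p = "\<lambda>t. a + t *\<^sub>R (x - a)"
  have D: "(f has_derivative ?D y) (at y)" if "y \<in> ball a r" for y
    using f that by (auto intro: has_derivative_frechet)
  have "((\<lambda>t. ?D (?p t) (x - a)) has_integral f (?p 1) - f (?p 0)) {0..1}"
  proof (rule fundamental_theorem_of_calculus)
    fix t :: real assume t: "t \<in> {0..1}"
    then have p: "?p t \<in> ball a r" using ray_in_ball[OF x, of t] by auto
    have "(?p has_derivative (\<lambda>s. s *\<^sub>R (x - a))) (at t)"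
      by (auto intro!: derivative_eq_intros)
    from has_derivative_compose[OF this D[OF p]]
    show "((\<lambda>t. f (?p t)) has_vector_derivative ?D (?p t) (x - a)) (at t within {0..1})"
      unfolding has_vector_derivative_def
      using linear_scale[OF has_derivative_linear[OF D[OF p]]]
      by (auto intro: has_derivative_at_withinI)
  qed simp
  then have "f x - f a = integral (cbox 0 1) (\<lambda>t. ?D (?p t) (x - a))"
    by (simp add: integral_unique)
  also have "\<dots> = integral (cbox 0 1) (\<lambda>t. \<Sum>b\<in>Basis. ((x - a) \<bullet> b) * (t ^ 0 * ?D (?p t) b))"
  proof (rule integral_cong)
    fix t :: real assume "t \<in> cbox 0 1"
    then have l: "linear (?D (?p t))"
      using has_derivative_linear[OF D[OF ray_in_ball[OF x]]] by blast
    have "?D (?p t) (x - a) = ?D (?p t) (\<Sum>b\<in>Basis. ((x - a) \<bullet> b) *\<^sub>R b)"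
      by (simp only: euclidean_representation)
    also have "\<dots> = (\<Sum>b\<in>Basis. ((x - a) \<bullet> b) * (t ^ 0 * ?D (?p t) b))"
      by (simp add: linear_sum[OF l] linear_scale[OF l])
    finally show "?D (?p t) (x - a) = \<dots>" .
  qed
  also have "\<dots> = (\<Sum>b\<in>Basis. integral (cbox 0 1) (\<lambda>t. ((x - a) \<bullet> b) * (t ^ 0 * ?D (?p t) b)))"
  proof (rule integral_sum)
    fix b :: 'b assume "b \<in> Basis"
    have "continuous_on (cbox 0 1) (\<lambda>t. t ^ 0 * ?D (?p t) b)"
      using f by (intro continuous_on_ray_section[OF _ x]) auto
    then show "(\<lambda>t. ((x - a) \<bullet> b) * (t ^ 0 * ?D (?p t) b)) integrable_on cbox 0 1"
      by (intro integrable_continuous continuous_on_mult_left)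
  qed simp
  finally show ?thesis by (simp add: ray_integral_def)
qed

subsection \<open>Smooth functions and tangent vectors\<close>

lemma sum_fun_apply: "(\<Sum>i\<in>I. f i) q = (\<Sum>i\<in>I. f i q)"
  by (induction I rule: infinite_finite_induct) auto

context smooth_manifold
begin

lemma open_chart:
  assumes "(U, c) \<in> atlas" shows "open U" "open (c ` U)"
  using chart_homeomorphism[OF assms] by auto

lemma chart_inverse: "(U, c) \<in> atlas \<Longrightarrow> q \<in> U \<Longrightarrow> inv_into U c (c q) = q"
  using chart_homeomorphism[of U c] by (auto simp: homeomorphism_def)

lemma open_chart_image:
  assumes "(U, c) \<in> atlas" "open W" "W \<subseteq> U" shows "open (c ` W)"
proof -
  have "openin (top_of_set (c ` U)) (c ` W)"
    using assms open_chart[OF assms(1)] chart_homeomorphism[OF assms(1)]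
    by (intro homeomorphism_imp_open_map[of U _ c "inv_into U c"]) (auto simp: openin_open_eq)
  then show ?thesis
    using openin_open_trans open_chart[OF assms(1)] by blast
qed

lemma smooth_functions_iff:
  "f \<in> smooth_functions atlas \<longleftrightarrow>
    (\<forall>U c k. (U, c) \<in> atlas \<longrightarrow> Ck_on k (c ` U) (\<lambda>x. f (inv_into U c x)))"
  by (auto simp: smooth_functions_def smooth_on_def o_def)

lemma smooth_const: "(\<lambda>_. a) \<in> smooth_functions atlas"
  by (simp add: smooth_functions_iff Ck_on_const)

lemma smooth_zero: "0 \<in> smooth_functions atlas"
  using smooth_const[of 0] by (simp add: func_zero)

lemma smooth_one: "1 \<in> smooth_functions atlas"
  using smooth_const[of 1] by (simp add: func_one)

lemma smooth_add:
  "f \<in> smooth_functions atlas \<Longrightarrow> g \<in> smooth_functions atlas \<Longrightarrow> f + g \<in> smooth_functions atlas"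
  by (auto simp: smooth_functions_iff intro!: Ck_on_add open_chart)

lemma smooth_mult:
  "f \<in> smooth_functions atlas \<Longrightarrow> g \<in> smooth_functions atlas \<Longrightarrow> f * g \<in> smooth_functions atlas"
  by (auto simp: smooth_functions_iff intro!: Ck_on_mult open_chart)

lemma smooth_scaleR:
  assumes "f \<in> smooth_functions atlas" shows "a *\<^sub>R f \<in> smooth_functions atlas"
proof -
  have "a *\<^sub>R f = (\<lambda>_. a) * f" by (simp add: fun_eq_iff)
  then show ?thesis using assms by (simp add: smooth_mult smooth_const)
qed

lemma smooth_uminus: "f \<in> smooth_functions atlas \<Longrightarrow> - f \<in> smooth_functions atlas"
  using smooth_scaleR[of f "- 1"] by simp

lemma smooth_diff:
  "f \<in> smooth_functions atlas \<Longrightarrow> g \<in> smooth_functions atlas \<Longrightarrow> f - g \<in> smooth_functions atlas"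
  using smooth_add[of f "- g"] smooth_uminus by simp

lemma smooth_sum:
  "(\<And>i. i \<in> I \<Longrightarrow> f i \<in> smooth_functions atlas) \<Longrightarrow> (\<Sum>i\<in>I. f i) \<in> smooth_functions atlas"
  by (induction I rule: infinite_finite_induct) (auto intro: smooth_add smooth_zero)

text \<open>The preimage \<open>N\<close> of \<open>K\<close> is compact, hence closed since the
  space is Hausdorff. So any other chart domain \<open>V\<close> is covered by two open sets:
  \<open>U \<inter> V\<close>, where the change of charts is smooth, and \<open>V - N\<close>, where
  the function vanishes.\<close>

lemma chart_extension_smooth:
  assumes U: "(U, c) \<in> atlas" and K: "compact K" "K \<subseteq> c ` U"
    and F: "\<And>k. Ck_on k (c ` U) F" "\<And>x. x \<in> c ` U \<Longrightarrow> x \<notin> K \<Longrightarrow> F x = 0"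
  shows "(\<lambda>q. if q \<in> U then F (c q) else 0) \<in> smooth_functions atlas"
  unfolding smooth_functions_iff
proof (intro allI impI)
  fix V d k
  assume V: "(V, d) \<in> atlas"
  let ?f = "\<lambda>y. if inv_into V d y \<in> U then F (c (inv_into V d y)) else 0"
  define N where "N = inv_into U c ` K"
  have "continuous_on K (inv_into U c)"
    using chart_homeomorphism[OF U] K(2) continuous_on_subset by (auto simp: homeomorphism_def)
  then have "closed N"
    unfolding N_def by (intro compact_imp_closed compact_continuous_image K)
  have NU: "N \<subseteq> U"
    using K(2) by (auto simp: N_def inv_into_into)
  have NF: "F (c q) = 0" if "q \<in> U" "q \<notin> N" for q
    using that F(2)[of "c q"] chart_inverse[OF U, of q] by (force simp: N_def)
  have A: "open (d ` (U \<inter> V))"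
    using open_chart[OF U] open_chart[OF V] by (intro open_chart_image[OF V]) auto
  have B: "open (d ` (V - N))"
    using \<open>closed N\<close> open_chart[OF V] by (intro open_chart_image[OF V]) auto
  have "Ck_on k (d ` (U \<inter> V)) ?f"
  proof (rule Ck_on_cong[OF A])
    have "Ck_on k (d ` (U \<inter> V)) (c \<circ> inv_into V d)"
      using charts_compatible[OF V U] by (simp add: smooth_on_def Int_commute)
    then show "Ck_on k (d ` (U \<inter> V)) (\<lambda>y. F ((c \<circ> inv_into V d) y))"
      by (rule Ck_on_compose[OF A _ _ F(1), rotated]) (auto simp: chart_inverse[OF V])
  qed (auto simp: chart_inverse[OF V])
  moreover have "Ck_on k (d ` (V - N)) ?f"
    by (rule Ck_on_cong[OF B _ Ck_on_const[of k _ 0]]) (auto simp: chart_inverse[OF V] NF)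
  ultimately have "Ck_on k (d ` (U \<inter> V) \<union> d ` (V - N)) ?f"
    by (rule Ck_on_Un[OF A B])
  moreover have "d ` (U \<inter> V) \<union> d ` (V - N) = d ` V"
    using NU by blast
  ultimately show "Ck_on k (d ` V) ?f" by simp
qed

text \<open>\<open>F\<close> is smooth only on the ball of radius \<open>R\<close>. Beyond the
  smaller radius \<open>r\<close> the bump vanishes, and the open ball of radius \<open>R\<close>
  together with the complement of the closed ball of radius \<open>r\<close> covers the chart
  image.\<close>

lemma bump_extension_smooth:
  assumes U: "(U, c) \<in> atlas" and r: "0 < r" "r < R" "cball a R \<subseteq> c ` U"
    and F: "\<And>k. Ck_on k (ball a R) F"
  shows "(\<lambda>q. if q \<in> U then bump r a (c q) * F (c q) else 0) \<in> smooth_functions atlas"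
proof (rule chart_extension_smooth[OF U compact_cball, of a r])
  show "cball a r \<subseteq> c ` U" using r by auto
  show "bump r a x * F x = 0" if "x \<notin> cball a r" for x
    using bump_support[of r x a] r that by auto
  fix k
  have op: "open (c ` U - cball a r)" using open_chart[OF U] by auto
  have "Ck_on k (ball a R) (\<lambda>x. bump r a x * F x)"
    by (intro Ck_on_mult Ck_on_bump F) auto
  moreover have "Ck_on k (c ` U - cball a r) (\<lambda>x. bump r a x * F x)"
    by (rule Ck_on_cong[OF op _ Ck_on_const[of k _ 0]]) (use r in \<open>auto simp: bump_support\<close>)
  ultimately have "Ck_on k (ball a R \<union> (c ` U - cball a r)) (\<lambda>x. bump r a x * F x)"
    by (rule Ck_on_Un[OF open_ball op])
  moreover have "ball a R \<union> (c ` U - cball a r) = c ` U"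
    using r by auto
  ultimately show "Ck_on k (c ` U) (\<lambda>x. bump r a x * F x)" by simp
qed

section \<open>Derivations at a point and the bound on their dimension\<close>

lemma tangent_add: "v \<in> tangent_space atlas p \<Longrightarrow> f \<in> smooth_functions atlas \<Longrightarrow>
    g \<in> smooth_functions atlas \<Longrightarrow> v (f + g) = v f + v g"
  and tangent_mult: "v \<in> tangent_space atlas p \<Longrightarrow> f \<in> smooth_functions atlas \<Longrightarrow>
    g \<in> smooth_functions atlas \<Longrightarrow> v (f * g) = f p * v g + g p * v f"
  and tangent_scaleR: "v \<in> tangent_space atlas p \<Longrightarrow> f \<in> smooth_functions atlas \<Longrightarrow>
    v (a *\<^sub>R f) = a * v f"
  and tangent_nonsmooth: "v \<in> tangent_space atlas p \<Longrightarrow> f \<notin> smooth_functions atlas \<Longrightarrow> v f = 0"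
  by (auto simp: tangent_space_def)

lemma tangent_zero: "v \<in> tangent_space atlas p \<Longrightarrow> v 0 = 0"
  using tangent_scaleR[of v p 0 0] smooth_zero by simp

lemma tangent_uminus: "v \<in> tangent_space atlas p \<Longrightarrow> f \<in> smooth_functions atlas \<Longrightarrow> v (- f) = - v f"
  using tangent_scaleR[of v p f "- 1"] by simp

lemma tangent_diff: "v \<in> tangent_space atlas p \<Longrightarrow> f \<in> smooth_functions atlas \<Longrightarrow>
    g \<in> smooth_functions atlas \<Longrightarrow> v (f - g) = v f - v g"
  using tangent_add[of v p f "- g"] by (simp add: tangent_uminus smooth_uminus)

lemma tangent_one: "v \<in> tangent_space atlas p \<Longrightarrow> v 1 = 0"
  using tangent_mult[of v p 1 1] smooth_one by simp

lemma tangent_sum: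
  assumes "v \<in> tangent_space atlas p" "\<And>i. i \<in> I \<Longrightarrow> f i \<in> smooth_functions atlas"
  shows "v (\<Sum>i\<in>I. f i) = (\<Sum>i\<in>I. v (f i))"
  using assms(2)
  by (induction I rule: infinite_finite_induct)
     (auto simp: tangent_zero[OF assms(1)] tangent_add[OF assms(1)] smooth_sum)

lemma tangent_space_subspace: "subspace (tangent_space atlas p)"
proof (rule subspaceI)
  show "x + y \<in> tangent_space atlas p"
    if "x \<in> tangent_space atlas p" "y \<in> tangent_space atlas p" for x y
    unfolding tangent_space_def mem_Collect_eq
    by (intro conjI ballI allI impI) (use that in \<open>simp_all add: tangent_add tangent_mult
        tangent_scaleR tangent_nonsmooth algebra_simps\<close>)
  show "a *\<^sub>R x \<in> tangent_space atlas p" if "x \<in> tangent_space atlas p" for a x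
    unfolding tangent_space_def mem_Collect_eq
    by (intro conjI ballI allI impI) (simp_all add: tangent_add[OF that] tangent_mult[OF that]
        tangent_scaleR[OF that] tangent_nonsmooth[OF that] algebra_simps)
qed (simp add: tangent_space_def)

text \<open>The functions \<open>X b\<close> are the chart coordinates centred at \<open>p\<close>,
  cut off by the bump. In the cut-off Hadamard expansion of f, the Leibniz rule leaves a positive
  multiple of \<open>v f\<close> on one side and multiples of the \<open>v (X b)\<close> on the
  other, because every \<open>X b\<close> vanishes at \<open>p\<close>.\<close>

lemma tangent_space_coordinates:
  obtains X :: "'b \<Rightarrow> 'a \<Rightarrow> real" where
    "\<And>v. v \<in> tangent_space atlas p \<Longrightarrow> (\<And>b. b \<in> Basis \<Longrightarrow> v (X b) = 0) \<Longrightarrow> v = 0"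
proof -
  obtain U c where U: "(U, c) \<in> atlas" and p: "p \<in> U"
    using UNIV_I[of p] unfolding charts_cover[symmetric] by auto
  define a where "a = c p"
  obtain R where R: "R > 0" "cball a R \<subseteq> c ` U"
    using open_chart(2)[OF U] p unfolding a_def by (metis open_contains_cball imageI)
  define r where "r = R / 2"
  have r: "0 < r" "r < R" using R by (auto simp: r_def)
  define cut where "cut F q = (if q \<in> U then bump r a (c q) * F (c q) else 0)"
    for F :: "'b \<Rightarrow> real" and q
  have cut_smooth: "cut F \<in> smooth_functions atlas" if "\<And>k. Ck_on k (ball a R) F" for F
    unfolding cut_def[abs_def] by (rule bump_extension_smooth[OF U r R(2) that])
  have cut_at: "cut F p = bump r a a * F a" for F
    using p by (simp add: cut_def a_def)
  define X where "X b = cut (\<lambda>x. (x - a) \<bullet> b)" for b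
  have lin: "Ck_on k (ball a R) (\<lambda>x. (x - a) \<bullet> b)" for k b
    using Ck_on_bounded_linear[OF open_ball bounded_linear_inner_left
        Ck_on_add[OF open_ball Ck_on_id[OF open_ball] Ck_on_const], of k a R "- a" b] by simp
  define \<beta> where "\<beta> = cut (\<lambda>_. 1)"
  have \<beta>: "\<beta> * \<beta> \<in> smooth_functions atlas"
    unfolding \<beta>_def by (intro smooth_mult cut_smooth Ck_on_const)
  have "v = 0" if v: "v \<in> tangent_space atlas p" and vX: "\<And>b. b \<in> Basis \<Longrightarrow> v (X b) = 0" for v
  proof
    fix f
    show "v f = 0 f"
    proof (cases "f \<in> smooth_functions atlas")
      case False
      then show ?thesis using v tangent_nonsmooth by simp
    next
      case f: True
      define F where "F x = f (inv_into U c x)" for x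
      define H where "H b = cut (ray_integral 0 a (\<lambda>y. frechet_derivative F (at y) b))" for b
      have F: "Ck_on k (ball a R) F" for k
      proof (rule Ck_on_subset[of k "c ` U"])
        show "Ck_on k (c ` U) F"
          using f U unfolding F_def[abs_def] smooth_functions_iff by blast
        show "ball a R \<subseteq> c ` U" using R(2) ball_subset_cball by blast
      qed
      have "Ck_on k (ball a R) (\<lambda>y. frechet_derivative F (at y) b)" for k b
        using F[of "Suc k"] by simp
      then have H: "H b \<in> smooth_functions atlas" for b
        unfolding H_def by (intro cut_smooth Ck_on_ray_integral)
      have X: "X b \<in> smooth_functions atlas" for b
        unfolding X_def by (intro cut_smooth lin)
      \<comment> \<open>The bump enters squared: one factor makes the coordinate global, the other
        its cofactor.\<close>
      have "f * (\<beta> * \<beta>) = f p *\<^sub>R (\<beta> * \<beta>) + (\<Sum>b\<in>Basis. X b * H b)"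
      proof
        fix q
        show "(f * (\<beta> * \<beta>)) q = (f p *\<^sub>R (\<beta> * \<beta>) + (\<Sum>b\<in>Basis. X b * H b)) q"
        proof (cases "q \<in> U \<and> c q \<in> ball a R")
          case True
          then have "f q = f p + (\<Sum>b\<in>Basis. ((c q - a) \<bullet> b) *
              ray_integral 0 a (\<lambda>y. frechet_derivative F (at y) b) (c q))"
            using hadamard[OF F, of "c q"] p by (simp add: F_def a_def chart_inverse[OF U])
          then show ?thesis
            using True by (simp add: sum_fun_apply \<beta>_def X_def H_def cut_def algebra_simps sum_distrib_left)
        next
          case False
          then have "cut G q = 0" for G
            using r bump_support[of r "c q" a] by (auto simp: cut_def)
          then show ?thesis by (simp add: sum_fun_apply \<beta>_def X_def)
        qed
      qed
      then have "v (f * (\<beta> * \<beta>)) = v (f p *\<^sub>R (\<beta> * \<beta>) + (\<Sum>b\<in>Basis. X b * H b))" by simp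
      then have "(\<beta> * \<beta>) p * v f = (\<Sum>b\<in>Basis. X b p * v (H b) + H b p * v (X b))"
        using f \<beta> X H
        by (simp add: tangent_mult[OF v] tangent_add[OF v] tangent_scaleR[OF v] tangent_sum[OF v]
            smooth_scaleR smooth_sum smooth_mult del: times_fun_apply)
      also have "\<dots> = 0"
        using vX by (simp add: X_def cut_at)
      finally show ?thesis
        using bump_center[OF r(1), of a] by (auto simp: \<beta>_def cut_at)
    qed
  qed
  then show ?thesis using that by blast
qed

text \<open>A derivation is determined by its values on the functions \<open>X b\<close>, so
  \<open>L\<close> embeds the tangent space linearly into the model space. The bound serves to
  exclude a fourth orthogonal vector.\<close>

theorem tangent_space_independent_bound:
  assumes "independent S" "S \<subseteq> tangent_space atlas p"
  shows "finite S \<and> card S \<le> DIM('b)"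
proof -
  obtain X :: "'b \<Rightarrow> 'a \<Rightarrow> real" where
    X: "\<And>v. v \<in> tangent_space atlas p \<Longrightarrow> (\<And>b. b \<in> Basis \<Longrightarrow> v (X b) = 0) \<Longrightarrow> v = 0"
    using tangent_space_coordinates by blast
  define L :: "'a tangent_vector \<Rightarrow> 'b" where "L v = (\<Sum>b\<in>Basis. v (X b) *\<^sub>R b)" for v
  have L: "linear L"
    by (rule linearI) (simp_all add: L_def scaleR_add_left sum.distrib scaleR_sum_right)
  have "span S \<subseteq> tangent_space atlas p"
    using assms(2) tangent_space_subspace by (simp add: span_minimal)
  moreover have "inj_on L (tangent_space atlas p)"
    unfolding linear_injective_on_subspace_0[OF L tangent_space_subspace]
  proof (intro ballI impI X)
    fix v b assume "L v = 0" "b \<in> (Basis :: 'b set)"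
    then show "v (X b) = 0"
      using inner_sum_left_Basis[of b "\<lambda>b. v (X b)"] by (simp add: L_def)
  qed
  ultimately have inj: "inj_on L (span S)" using inj_on_subset by blast
  have "independent (L ` S)"
    by (rule linear_independent_injective_image[OF L assms(1) inj])
  then have "finite (L ` S)" "card (L ` S) \<le> DIM('b)" using independent_bound by auto
  moreover have "inj_on L S" using inj inj_on_subset span_superset by blast
  ultimately show ?thesis using card_image finite_image_iff by metis
qed

end

subsection \<open>Vector fields and Lie brackets\<close>

lemma field_scale_apply: "(s \<odot> X) p = s p *\<^sub>R X p"
  by (simp add: field_scale_def)

context smooth_manifold
begin

lemmas tangent_space_closed =
  subspace_0[OF tangent_space_subspace] subspace_add[OF tangent_space_subspace]
  subspace_diff[OF tangent_space_subspace] subspace_neg[OF tangent_space_subspace]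
  subspace_scale[OF tangent_space_subspace] subspace_sum[OF tangent_space_subspace]

lemma field_at: "X \<in> vector_fields atlas \<Longrightarrow> X p \<in> tangent_space atlas p"
  by (simp add: vector_fields_def)

lemma field_deriv_smooth:
  "X \<in> vector_fields atlas \<Longrightarrow> f \<in> smooth_functions atlas \<Longrightarrow>
    field_deriv X f \<in> smooth_functions atlas"
  by (simp add: vector_fields_def field_deriv_def)

lemma field_deriv_nonsmooth:
  "X \<in> vector_fields atlas \<Longrightarrow> f \<notin> smooth_functions atlas \<Longrightarrow> field_deriv X f = 0"
  by (auto simp: field_deriv_def fun_eq_iff intro: tangent_nonsmooth field_at)

lemma field_deriv_simps:
  assumes "X \<in> vector_fields atlas"
  shows "f \<in> smooth_functions atlas \<Longrightarrow> g \<in> smooth_functions atlas \<Longrightarrow>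
      field_deriv X (f + g) = field_deriv X f + field_deriv X g"
    and "f \<in> smooth_functions atlas \<Longrightarrow> g \<in> smooth_functions atlas \<Longrightarrow>
      field_deriv X (f - g) = field_deriv X f - field_deriv X g"
    and "f \<in> smooth_functions atlas \<Longrightarrow> g \<in> smooth_functions atlas \<Longrightarrow>
      field_deriv X (f * g) = f * field_deriv X g + g * field_deriv X f"
    and "f \<in> smooth_functions atlas \<Longrightarrow> field_deriv X (a *\<^sub>R f) = a *\<^sub>R field_deriv X f"
  by (simp_all add: field_deriv_def fun_eq_iff tangent_add[OF field_at[OF assms]]
      tangent_diff[OF field_at[OF assms]] tangent_mult[OF field_at[OF assms]]
      tangent_scaleR[OF field_at[OF assms]] del: times_fun_apply plus_fun_apply)
     (simp_all add: field_deriv_def)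

lemma vector_fieldI:
  assumes "\<And>p. X p \<in> tangent_space atlas p"
    and "\<And>f. f \<in> smooth_functions atlas \<Longrightarrow> field_deriv X f \<in> smooth_functions atlas"
  shows "X \<in> vector_fields atlas"
  using assms by (simp add: vector_fields_def field_deriv_def)

lemma field_deriv_left_simps:
  "field_deriv (X + Y) f = field_deriv X f + field_deriv Y f"
  "field_deriv (a *\<^sub>R X) f = a *\<^sub>R field_deriv X f"
  "field_deriv (s \<odot> X) f = s * field_deriv X f"
  by (simp_all add: field_deriv_def fun_eq_iff field_scale_def)

lemma field_add: "X \<in> vector_fields atlas \<Longrightarrow> Y \<in> vector_fields atlas \<Longrightarrow> X + Y \<in> vector_fields atlas"
  by (rule vector_fieldI)
     (simp_all add: field_deriv_left_simps smooth_add field_deriv_smooth field_at tangent_space_closed)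

lemma field_scaleR: "X \<in> vector_fields atlas \<Longrightarrow> a *\<^sub>R X \<in> vector_fields atlas"
  by (rule vector_fieldI)
     (simp_all add: field_deriv_left_simps smooth_scaleR field_deriv_smooth field_at tangent_space_closed)

lemma field_scale:
  "s \<in> smooth_functions atlas \<Longrightarrow> X \<in> vector_fields atlas \<Longrightarrow> s \<odot> X \<in> vector_fields atlas"
  by (rule vector_fieldI)
     (simp_all add: field_deriv_left_simps smooth_mult field_deriv_smooth,
      simp add: field_scale_def field_at tangent_space_closed)

lemma field_uminus: "X \<in> vector_fields atlas \<Longrightarrow> - X \<in> vector_fields atlas"
  using field_scaleR[of X "- 1"] by simp

lemma field_diff: "X \<in> vector_fields atlas \<Longrightarrow> Y \<in> vector_fields atlas \<Longrightarrow> X - Y \<in> vector_fields atlas"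
  using field_add[of X "- Y"] field_uminus by simp

lemma field_zero: "X \<in> vector_fields atlas \<Longrightarrow> 0 \<in> vector_fields atlas"
  using field_scaleR[of X 0] by simp

lemma lie_bracket_apply:
  "lie_bracket X Y p f = X p (field_deriv Y f) - Y p (field_deriv X f)"
  by (simp add: lie_bracket_def)

lemma field_deriv_lie_bracket:
  "field_deriv (lie_bracket X Y) f =
    field_deriv X (field_deriv Y f) - field_deriv Y (field_deriv X f)"
  by (simp add: fun_eq_iff field_deriv_def lie_bracket_def)

lemma lie_bracket_field:
  assumes X: "X \<in> vector_fields atlas" and Y: "Y \<in> vector_fields atlas"
  shows "lie_bracket X Y \<in> vector_fields atlas"
proof (rule vector_fieldI)
  fix p
  note T = field_at[OF X, of p] field_at[OF Y, of p]
  note S = field_deriv_smooth[OF X] field_deriv_smooth[OF Y] smooth_add smooth_mult smooth_scaleR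
  note lin = tangent_add[OF T(1)] tangent_add[OF T(2)] tangent_mult[OF T(1)] tangent_mult[OF T(2)]
    tangent_scaleR[OF T(1)] tangent_scaleR[OF T(2)] tangent_zero[OF T(1)] tangent_zero[OF T(2)]
  show "lie_bracket X Y p \<in> tangent_space atlas p"
    unfolding tangent_space_def mem_Collect_eq
  proof (intro conjI ballI allI impI)
    fix f g assume "f \<in> smooth_functions atlas" "g \<in> smooth_functions atlas"
    \<comment> \<open>For the product, the mixed terms with one derivative on each factor are
      symmetric in \<open>X\<close> and \<open>Y\<close> and cancel.\<close>
    then show "lie_bracket X Y p (f + g) = lie_bracket X Y p f + lie_bracket X Y p g"
      "lie_bracket X Y p (f * g) = f p * lie_bracket X Y p g + g p * lie_bracket X Y p f"
      by (simp_all add: lie_bracket_apply field_deriv_simps[OF X] field_deriv_simps[OF Y] S lin)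
         (simp add: field_deriv_def algebra_simps)
  next
    fix f a assume "f \<in> smooth_functions atlas"
    then show "lie_bracket X Y p (a *\<^sub>R f) = a * lie_bracket X Y p f"
      by (simp add: lie_bracket_apply field_deriv_simps[OF X] field_deriv_simps[OF Y] S lin
          right_diff_distrib)
  next
    fix f assume "f \<notin> smooth_functions atlas"
    then show "lie_bracket X Y p f = 0"
      by (simp add: lie_bracket_apply field_deriv_nonsmooth[OF X] field_deriv_nonsmooth[OF Y] lin)
  qed
next
  fix f assume "f \<in> smooth_functions atlas"
  then show "field_deriv (lie_bracket X Y) f \<in> smooth_functions atlas"
    by (simp add: field_deriv_lie_bracket smooth_diff field_deriv_smooth X Y)
qed

lemmas field_closed = field_add field_diff field_uminus field_scaleR field_scale lie_bracket_field

text \<open>Testing on smooth functions suffices since tangent vectors are 0 on all others. It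
  reduces identities between brackets to identities between iterated derivatives.\<close>

lemma field_eqI:
  assumes "X \<in> vector_fields atlas" "Y \<in> vector_fields atlas"
    and "\<And>f. f \<in> smooth_functions atlas \<Longrightarrow> field_deriv X f = field_deriv Y f"
  shows "X = Y"
proof (rule ext, rule ext)
  fix p f
  have "field_deriv X f = field_deriv Y f"
    using assms field_deriv_nonsmooth by (cases "f \<in> smooth_functions atlas") auto
  then show "X p f = Y p f" by (simp add: field_deriv_def fun_eq_iff)
qed

lemma lie_bracket_antisym: "lie_bracket Y X = - lie_bracket X Y"
  by (simp add: lie_bracket_def fun_eq_iff)

lemma lie_bracket_self: "lie_bracket X X = 0"
  by (simp add: lie_bracket_def fun_eq_iff)

lemma lie_bracket_add_right:
  assumes "X \<in> vector_fields atlas" "Y \<in> vector_fields atlas" "Z \<in> vector_fields atlas"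
  shows "lie_bracket X (Y + Z) = lie_bracket X Y + lie_bracket X Z"
  using assms by (intro field_eqI field_closed)
    (simp_all add: field_deriv_lie_bracket field_deriv_left_simps field_deriv_simps field_deriv_smooth)

lemma lie_bracket_scale_right:
  assumes "s \<in> smooth_functions atlas" "X \<in> vector_fields atlas" "Y \<in> vector_fields atlas"
  shows "lie_bracket X (s \<odot> Y) = field_deriv X s \<odot> Y + s \<odot> lie_bracket X Y"
  using assms by (intro field_eqI field_closed field_deriv_smooth)
    (simp_all add: field_deriv_lie_bracket field_deriv_left_simps field_deriv_simps field_deriv_smooth
      algebra_simps)

lemma lie_bracket_uminus_right:
  assumes "X \<in> vector_fields atlas" "Y \<in> vector_fields atlas"
  shows "lie_bracket X (- Y) = - lie_bracket X Y"
proof -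
  have "lie_bracket X (- Y) + lie_bracket X Y = lie_bracket X 0"
    using lie_bracket_add_right[of X "- Y" Y] assms by (simp add: field_uminus)
  also have "\<dots> = 0"
    using lie_bracket_add_right[of X 0 0] assms by (simp add: field_zero)
  finally show ?thesis by (simp add: eq_neg_iff_add_eq_0)
qed

lemma jacobi_identity:
  assumes "X \<in> vector_fields atlas" "Y \<in> vector_fields atlas" "Z \<in> vector_fields atlas"
  shows "lie_bracket X (lie_bracket Y Z) + lie_bracket Y (lie_bracket Z X) +
    lie_bracket Z (lie_bracket X Y) = 0"
proof (rule field_eqI)
  fix f assume "f \<in> smooth_functions atlas"
  then show "field_deriv (lie_bracket X (lie_bracket Y Z) + lie_bracket Y (lie_bracket Z X) +
      lie_bracket Z (lie_bracket X Y)) f = field_deriv 0 f"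
    using assms
    by (simp add: field_deriv_lie_bracket field_deriv_left_simps field_deriv_simps field_deriv_smooth)
       (simp add: field_deriv_def fun_eq_iff)
qed (use assms in \<open>auto intro!: field_closed intro: field_zero\<close>)

end

subsection \<open>Riemannian metrics\<close>

context riemannian_manifold
begin

lemma metric_linear_right:
  assumes u: "u \<in> tangent_space atlas p"
  shows "v \<in> tangent_space atlas p \<Longrightarrow> w \<in> tangent_space atlas p \<Longrightarrow> g p u (v + w) = g p u v + g p u w"
    and "v \<in> tangent_space atlas p \<Longrightarrow> g p u (a *\<^sub>R v) = a * g p u v"
    and "v \<in> tangent_space atlas p \<Longrightarrow> w \<in> tangent_space atlas p \<Longrightarrow> g p u (v - w) = g p u v - g p u w"
    and "v \<in> tangent_space atlas p \<Longrightarrow> g p u (- v) = - g p u v"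
    and "g p u 0 = 0"
proof -
  have add: "g p u (v + w) = g p u v + g p u w"
    if "v \<in> tangent_space atlas p" "w \<in> tangent_space atlas p" for v w
    using metric_linear[OF u] that unfolding linear_between_def by blast
  have scale: "g p u (a *\<^sub>R v) = a * g p u v" if "v \<in> tangent_space atlas p" for a v
    using metric_linear[OF u] that unfolding linear_between_def real_scaleR_def by blast
  have neg: "g p u (- v) = - g p u v" if "v \<in> tangent_space atlas p" for v
    using scale[OF that, of "- 1"] by simp
  have diff: "g p u (v - w) = g p u v - g p u w"
    if "v \<in> tangent_space atlas p" "w \<in> tangent_space atlas p" for v w
    using add[OF that(1) tangent_space_closed(4)[OF that(2)]] neg[OF that(2)] by simp
  show "v \<in> tangent_space atlas p \<Longrightarrow> w \<in> tangent_space atlas p \<Longrightarrow> g p u (v + w) = g p u v + g p u w"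
    by (rule add)
  show "v \<in> tangent_space atlas p \<Longrightarrow> g p u (a *\<^sub>R v) = a * g p u v"
    by (rule scale)
  show "v \<in> tangent_space atlas p \<Longrightarrow> w \<in> tangent_space atlas p \<Longrightarrow> g p u (v - w) = g p u v - g p u w"
    by (rule diff)
  show "v \<in> tangent_space atlas p \<Longrightarrow> g p u (- v) = - g p u v"
    by (rule neg)
  show "g p u 0 = 0" using scale[OF u, of 0] by simp
qed

lemma metric_linear_left:
  assumes v: "v \<in> tangent_space atlas p"
  shows "u \<in> tangent_space atlas p \<Longrightarrow> w \<in> tangent_space atlas p \<Longrightarrow> g p (u + w) v = g p u v + g p w v"
    and "u \<in> tangent_space atlas p \<Longrightarrow> g p (a *\<^sub>R u) v = a * g p u v"
    and "u \<in> tangent_space atlas p \<Longrightarrow> w \<in> tangent_space atlas p \<Longrightarrow> g p (u - w) v = g p u v - g p w v"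
    and "u \<in> tangent_space atlas p \<Longrightarrow> g p (- u) v = - g p u v"
    and "g p 0 v = 0"
  by (simp_all add: metric_sym[OF _ v] metric_linear_right[OF v] tangent_space_closed)

lemmas metric_simps = metric_linear_right metric_linear_left

lemma metric_zero_iff: "u \<in> tangent_space atlas p \<Longrightarrow> g p u u = 0 \<longleftrightarrow> u = 0"
  using metric_pos[of u p] metric_linear_right(5)[of u p] by (cases "u = 0") auto

lemma metric_sum_right:
  assumes "u \<in> tangent_space atlas p" "\<And>i. i \<in> I \<Longrightarrow> v i \<in> tangent_space atlas p"
  shows "g p u (\<Sum>i\<in>I. v i) = (\<Sum>i\<in>I. g p u (v i))"
  using assms(2)
  by (induction I rule: infinite_finite_induct)
     (simp_all add: metric_linear_right[OF assms(1)] tangent_space_closed)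

lemma orthogonal_imp_independent:
  assumes "finite S" "S \<subseteq> tangent_space atlas p" "0 \<notin> S"
    and "\<And>u v. u \<in> S \<Longrightarrow> v \<in> S \<Longrightarrow> u \<noteq> v \<Longrightarrow> g p u v = 0"
  shows "independent S"
proof
  assume "dependent S"
  then obtain a u where sum: "(\<Sum>v\<in>S. a v *\<^sub>R v) = 0" and u: "u \<in> S" and au: "a u \<noteq> 0"
    unfolding dependent_finite[OF assms(1)] by blast
  have T: "v \<in> tangent_space atlas p" if "v \<in> S" for v using assms(2) that by auto
  have "0 = g p u (\<Sum>v\<in>S. a v *\<^sub>R v)"
    using metric_linear_right(5)[OF T[OF u]] by (simp add: sum)
  also have "\<dots> = (\<Sum>v\<in>S. a v * g p u v)"
    using T u by (subst metric_sum_right) (auto simp: metric_simps tangent_space_closed)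
  also have "\<dots> = (\<Sum>v\<in>S. if v = u then a u * g p u u else 0)"
    using assms(4) u by (intro sum.cong) auto
  also have "\<dots> = a u * g p u u" using u assms(1) by simp
  finally have "g p u u = 0" using au by simp
  moreover have "u \<noteq> 0" using u assms(3) by metis
  ultimately show False using metric_pos[OF T[OF u]] by simp
qed

text \<open>A nonzero remainder would be orthogonal to the three given vectors, and four nonzero
  pairwise orthogonal vectors exceed the dimension bound.\<close>

lemma orthogonal_expansion_dim3:
  assumes "DIM('b) = 3"
    and T: "e1 \<in> tangent_space atlas p" "e2 \<in> tangent_space atlas p" "e3 \<in> tangent_space atlas p"
      "w \<in> tangent_space atlas p"
    and nz: "e1 \<noteq> 0" "e2 \<noteq> 0" "e3 \<noteq> 0"
    and orth: "g p e1 e2 = 0" "g p e1 e3 = 0" "g p e2 e3 = 0"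
  shows "w = (g p w e1 / g p e1 e1) *\<^sub>R e1 + (g p w e2 / g p e2 e2) *\<^sub>R e2 +
    (g p w e3 / g p e3 e3) *\<^sub>R e3"
proof (rule ccontr)
  define r where "r = w - ((g p w e1 / g p e1 e1) *\<^sub>R e1 + (g p w e2 / g p e2 e2) *\<^sub>R e2 +
    (g p w e3 / g p e3 e3) *\<^sub>R e3)"
  assume "\<not> ?thesis"
  then have r0: "r \<noteq> 0" by (simp add: r_def)
  have rT: "r \<in> tangent_space atlas p"
    unfolding r_def by (intro tangent_space_closed T)
  have pos: "g p e1 e1 \<noteq> 0" "g p e2 e2 \<noteq> 0" "g p e3 e3 \<noteq> 0"
    using metric_pos[OF T(1) nz(1)] metric_pos[OF T(2) nz(2)] metric_pos[OF T(3) nz(3)] by simp_all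
  have orth': "g p e2 e1 = 0" "g p e3 e1 = 0" "g p e3 e2 = 0"
    using orth metric_sym[OF T(1) T(2)] metric_sym[OF T(1) T(3)] metric_sym[OF T(2) T(3)] by simp_all
  have rorth: "g p r e1 = 0" "g p r e2 = 0" "g p r e3 = 0"
    unfolding r_def using pos T orth orth' by (simp_all add: metric_simps tangent_space_closed)
  then have rorth': "g p e1 r = 0" "g p e2 r = 0" "g p e3 r = 0"
    using metric_sym[OF rT T(1)] metric_sym[OF rT T(2)] metric_sym[OF rT T(3)] by simp_all
  have rr: "g p r r \<noteq> 0" using metric_pos[OF rT r0] by simp
  have dist: "e1 \<noteq> e2" "e1 \<noteq> e3" "e2 \<noteq> e3" "r \<noteq> e1" "r \<noteq> e2" "r \<noteq> e3"
    using orth pos rorth rr by auto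
  have "independent {r, e1, e2, e3}"
    using T rT nz r0 orth orth' rorth rorth'
    by (intro orthogonal_imp_independent[of _ p]) auto
  then have "card {r, e1, e2, e3} \<le> DIM('b)"
    using tangent_space_independent_bound[of "{r, e1, e2, e3}" p] T rT by auto
  then show False using dist assms(1) by simp
qed

end

subsection \<open>Symmetries of the curvature tensor\<close>

context levi_civita
begin

lemma conn_zero_left:
  assumes "X \<in> vector_fields atlas" shows "D 0 X = 0"
  using conn_add_left[OF field_zero[OF assms] field_zero[OF assms] assms] by simp

lemma conn_uminus_left:
  assumes "X \<in> vector_fields atlas" "Y \<in> vector_fields atlas" shows "D (- X) Y = - D X Y"
  using conn_add_left[OF field_uminus[OF assms(1)] assms] conn_zero_left[OF assms(2)]
  by (simp add: eq_neg_iff_add_eq_0)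

lemma conn_diff_right:
  assumes "X \<in> vector_fields atlas" "Y \<in> vector_fields atlas" "Z \<in> vector_fields atlas"
  shows "D X (Y - Z) = D X Y - D X Z"
  using conn_add_right[OF assms(1) field_diff[OF assms(2,3)] assms(3)] by (simp add: eq_diff_eq)

lemma curvature_field:
  "X \<in> vector_fields atlas \<Longrightarrow> Y \<in> vector_fields atlas \<Longrightarrow> Z \<in> vector_fields atlas \<Longrightarrow>
    curvature D X Y Z \<in> vector_fields atlas"
  unfolding curvature_def by (intro field_closed conn_field)

lemma curvature_antisym:
  assumes "X \<in> vector_fields atlas" "Y \<in> vector_fields atlas" "Z \<in> vector_fields atlas"
  shows "curvature D Y X Z = - curvature D X Y Z"
  using assms unfolding curvature_def lie_bracket_antisym[of Y X]
  by (simp add: conn_uminus_left lie_bracket_field)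

text \<open>Regrouped, the cyclic sum contains D applied to differences
  \<open>D Y Z - D Z Y\<close>. Vanishing torsion turns it into the cyclic sum of double brackets,
  which the Jacobi identity annihilates.\<close>

lemma bianchi_identity:
  assumes X: "X \<in> vector_fields atlas" and Y: "Y \<in> vector_fields atlas"
    and Z: "Z \<in> vector_fields atlas"
  shows "curvature D X Y Z + curvature D Y Z X + curvature D Z X Y = 0"
proof -
  have *: "D X (D Y Z) - D X (D Z Y) - D (lie_bracket Y Z) X = lie_bracket X (lie_bracket Y Z)"
    if "X \<in> vector_fields atlas" "Y \<in> vector_fields atlas" "Z \<in> vector_fields atlas" for X Y Z
    using that torsion_free[of X "lie_bracket Y Z"]
    by (simp add: conn_diff_right[symmetric] torsion_free lie_bracket_field conn_field)
  have "curvature D X Y Z + curvature D Y Z X + curvature D Z X Y =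
      lie_bracket X (lie_bracket Y Z) + lie_bracket Y (lie_bracket Z X) +
      lie_bracket Z (lie_bracket X Y)"
    unfolding *[OF X Y Z, symmetric] *[OF Y Z X, symmetric] *[OF Z X Y, symmetric] curvature_def
    by (simp add: algebra_simps)
  then show ?thesis using jacobi_identity[OF X Y Z] by simp
qed

text \<open>The arguments are fields, since dependence on their values at \<open>p\<close> alone is
  yet to be proved; it is built in for the fourth one.\<close>

definition riemann :: "'a \<Rightarrow> 'a vector_field \<Rightarrow> 'a vector_field \<Rightarrow> 'a vector_field \<Rightarrow>
    'a vector_field \<Rightarrow> real" where
  "riemann p X Y Z W = g p (curvature D X Y Z p) (W p)"

lemma riemann_antisym12:
  assumes "X \<in> vector_fields atlas" "Y \<in> vector_fields atlas" "Z \<in> vector_fields atlas"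
    "W \<in> vector_fields atlas"
  shows "riemann p Y X Z W = - riemann p X Y Z W"
  using assms by (simp add: riemann_def curvature_antisym[of X Y Z] metric_simps field_at curvature_field)

text \<open>The bracket acts on the function g(Z,W) as the commutator of two derivatives. Metric
  compatibility, used twice, expands each; the products of first derivatives are symmetric in
  \<open>X\<close> and \<open>Y\<close> and cancel.\<close>

lemma riemann_antisym34:
  assumes X: "X \<in> vector_fields atlas" and Y: "Y \<in> vector_fields atlas"
    and Z: "Z \<in> vector_fields atlas" and W: "W \<in> vector_fields atlas"
  shows "riemann p X Y W Z = - riemann p X Y Z W"
proof -
  have second: "field_deriv X (field_deriv Y (app2 g Z W)) =
      app2 g (D X (D Y Z)) W + app2 g (D Y Z) (D X W) + (app2 g (D X Z) (D Y W) +
      app2 g Z (D X (D Y W)))"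
    if X: "X \<in> vector_fields atlas" and Y: "Y \<in> vector_fields atlas" for X Y
    using X Y Z W
    by (simp add: metric_compatible field_deriv_simps metric_smooth conn_field)
  have "app2 g (D (lie_bracket X Y) Z) W + app2 g Z (D (lie_bracket X Y) W) =
      field_deriv X (field_deriv Y (app2 g Z W)) - field_deriv Y (field_deriv X (app2 g Z W))"
    using metric_compatible[OF lie_bracket_field[OF X Y] Z W] by (simp add: field_deriv_lie_bracket)
  from fun_cong[OF this[unfolded second[OF X Y] second[OF Y X]], of p]
  have "g p (D (lie_bracket X Y) Z p) (W p) + g p (Z p) (D (lie_bracket X Y) W p) =
      g p (D X (D Y Z) p) (W p) + g p (Z p) (D X (D Y W) p) -
      (g p (D Y (D X Z) p) (W p) + g p (Z p) (D Y (D X W) p))"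
    by (simp add: app2_def)
  moreover have "riemann p X Y W Z = g p (Z p) (curvature D X Y W p)"
    unfolding riemann_def by (intro metric_sym field_at curvature_field X Y Z W)
  ultimately show ?thesis
    using X Y Z W
    by (simp add: riemann_def curvature_def metric_simps field_at conn_field lie_bracket_field
        tangent_space_closed)
qed

lemma riemann_bianchi:
  assumes X: "X \<in> vector_fields atlas" and Y: "Y \<in> vector_fields atlas"
    and Z: "Z \<in> vector_fields atlas" and W: "W \<in> vector_fields atlas"
  shows "riemann p X Y Z W + riemann p Y Z X W + riemann p Z X Y W = 0"
proof -
  have "riemann p X Y Z W + riemann p Y Z X W + riemann p Z X Y W =
      g p ((curvature D X Y Z + curvature D Y Z X + curvature D Z X Y) p) (W p)"
    using assms by (simp add: riemann_def metric_simps field_at curvature_field tangent_space_closed)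
  then show ?thesis
    using assms by (simp add: bianchi_identity[OF X Y Z] metric_linear_left(5)[OF field_at])
qed

text \<open>The classical octahedron argument: the Bianchi identities for the four rotations of X,
  Y, Z, W combine linearly once the antisymmetries identify their terms.\<close>

lemma riemann_pair_sym:
  assumes X: "X \<in> vector_fields atlas" and Y: "Y \<in> vector_fields atlas"
    and Z: "Z \<in> vector_fields atlas" and W: "W \<in> vector_fields atlas"
  shows "riemann p Z W X Y = riemann p X Y Z W"
  using riemann_bianchi[OF X Y Z W, of p] riemann_bianchi[OF Y Z W X, of p]
    riemann_bianchi[OF Z W X Y, of p] riemann_bianchi[OF W X Y Z, of p]
    riemann_antisym12[OF X Z Y W, of p] riemann_antisym34[OF Y Z X W, of p]
    riemann_antisym34[OF Z W X Y, of p] riemann_antisym12[OF Y W Z X, of p]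
    riemann_antisym34[OF Y W X Z, of p] riemann_antisym12[OF X W Z Y, of p]
    riemann_antisym34[OF X W Y Z, of p] riemann_antisym34[OF X Z Y W, of p]
    riemann_antisym12[OF X W Y Z, of p] riemann_antisym34[OF X Y Z W, of p]
  by linarith

section \<open>Pointwise dependence of the curvature on its arguments\<close>

text \<open>Locality and linearity in one statement: coefficients 1 and 0 exchange a field for
  another with the same value at \<open>p\<close>, general ones expand it in a basis of a
  plane.\<close>

lemma riemann_slot4:
  assumes "X \<in> vector_fields atlas" "Y \<in> vector_fields atlas" "Z \<in> vector_fields atlas"
    and "A \<in> vector_fields atlas" "B \<in> vector_fields atlas"
    and "W p = a *\<^sub>R A p + b *\<^sub>R B p"
  shows "riemann p X Y Z W = a * riemann p X Y Z A + b * riemann p X Y Z B"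
  using assms by (simp add: riemann_def metric_simps field_at curvature_field tangent_space_closed)

lemma riemann_slot3:
  assumes "X \<in> vector_fields atlas" "Y \<in> vector_fields atlas" "Z \<in> vector_fields atlas"
    and "A \<in> vector_fields atlas" "B \<in> vector_fields atlas" "W \<in> vector_fields atlas"
    and "Z p = a *\<^sub>R A p + b *\<^sub>R B p"
  shows "riemann p X Y Z W = a * riemann p X Y A W + b * riemann p X Y B W"
  using riemann_slot4[where p = p and W = Z, OF assms(1,2,6,4,5,7)] riemann_antisym34[OF assms(1,2,3,6), of p]
    riemann_antisym34[OF assms(1,2,4,6), of p] riemann_antisym34[OF assms(1,2,5,6), of p]
  by simp

lemma riemann_slot2:
  assumes "X \<in> vector_fields atlas" "Y \<in> vector_fields atlas" "Z \<in> vector_fields atlas"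
    and "A \<in> vector_fields atlas" "B \<in> vector_fields atlas" "W \<in> vector_fields atlas"
    and "Y p = a *\<^sub>R A p + b *\<^sub>R B p"
  shows "riemann p X Y Z W = a * riemann p X A Z W + b * riemann p X B Z W"
  using riemann_slot4[where p = p and W = Y, OF assms(3,6,1,4,5,7)] riemann_pair_sym[OF assms(1,2,3,6), of p]
    riemann_pair_sym[OF assms(1,4,3,6), of p] riemann_pair_sym[OF assms(1,5,3,6), of p]
  by simp

lemma riemann_slot1:
  assumes "X \<in> vector_fields atlas" "Y \<in> vector_fields atlas" "Z \<in> vector_fields atlas"
    and "A \<in> vector_fields atlas" "B \<in> vector_fields atlas" "W \<in> vector_fields atlas"
    and "X p = a *\<^sub>R A p + b *\<^sub>R B p"
  shows "riemann p X Y Z W = a * riemann p A Y Z W + b * riemann p B Y Z W"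
  using riemann_slot3[where p = p and Z = X, OF assms(3,6,1,4,5,2,7)] riemann_pair_sym[OF assms(1,2,3,6), of p]
    riemann_pair_sym[OF assms(4,2,3,6), of p] riemann_pair_sym[OF assms(5,2,3,6), of p]
  by simp

lemma riemann_plane_left:
  assumes "X \<in> vector_fields atlas" "Y \<in> vector_fields atlas" "Z \<in> vector_fields atlas"
    and "A \<in> vector_fields atlas" "B \<in> vector_fields atlas" "W \<in> vector_fields atlas"
    and "X p = x1 *\<^sub>R A p + x2 *\<^sub>R B p" "Y p = y1 *\<^sub>R A p + y2 *\<^sub>R B p"
  shows "riemann p X Y Z W = (x1 * y2 - x2 * y1) * riemann p A B Z W"
proof -
  have "riemann p A A Z W = 0" "riemann p B B Z W = 0"
    using riemann_antisym12[OF assms(4,4,3,6), of p] riemann_antisym12[OF assms(5,5,3,6), of p]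
    by simp_all
  then show ?thesis
    by (simp add: riemann_slot1[where p = p and X = X, OF assms(1,2,3,4,5,6,7)]
        riemann_slot2[where p = p and Y = Y, OF _ assms(2,3,4,5,6,8)]
        assms(4,5) riemann_antisym12[OF assms(4,5,3,6)] algebra_simps)
qed

text \<open>Alternation in each pair lets the curvature of a plane factor through two determinants.
  The minus sign comes from taking R(A,B,B,A), the sectional curvature up to scale, as the one
  component.\<close>

lemma riemann_plane:
  assumes "X \<in> vector_fields atlas" "Y \<in> vector_fields atlas" "Z \<in> vector_fields atlas"
    and "A \<in> vector_fields atlas" "B \<in> vector_fields atlas" "W \<in> vector_fields atlas"
    and "X p = x1 *\<^sub>R A p + x2 *\<^sub>R B p" "Y p = y1 *\<^sub>R A p + y2 *\<^sub>R B p"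
    and "Z p = z1 *\<^sub>R A p + z2 *\<^sub>R B p" "W p = w1 *\<^sub>R A p + w2 *\<^sub>R B p"
  shows "riemann p X Y Z W = - ((x1 * y2 - x2 * y1) * (z1 * w2 - z2 * w1) * riemann p A B B A)"
proof -
  have "riemann p X Y Z W = (x1 * y2 - x2 * y1) * riemann p A B Z W"
    using assms by (intro riemann_plane_left)
  also have "riemann p A B Z W = riemann p Z W A B"
    using assms by (intro riemann_pair_sym)
  also have "\<dots> = (z1 * w2 - z2 * w1) * riemann p A B A B"
    using assms by (intro riemann_plane_left)
  also have "riemann p A B A B = - riemann p A B B A"
    using assms by (intro riemann_antisym34)
  finally show ?thesis by simp
qed

text \<open>The definite description is meaningful on values of fields. For two choices of
  extensions the difference \<open>W\<close> of the curvatures is a field; exchanging the extensions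
  slot by slot in the pairing with \<open>W\<close> gives g(W,W) = 0 at \<open>p\<close>.\<close>

lemma curvature_at_eq:
  assumes X: "X \<in> vector_fields atlas" and Y: "Y \<in> vector_fields atlas"
    and Z: "Z \<in> vector_fields atlas"
  shows "curvature_at atlas D p (X p) (Y p) (Z p) = curvature D X Y Z p"
  unfolding curvature_at_def
proof (rule the_equality)
  show "\<forall>X'\<in>vector_fields atlas. \<forall>Y'\<in>vector_fields atlas. \<forall>Z'\<in>vector_fields atlas.
      X' p = X p \<and> Y' p = Y p \<and> Z' p = Z p \<longrightarrow> curvature D X' Y' Z' p = curvature D X Y Z p"
  proof (intro ballI impI)
    fix X' Y' Z'
    assume X': "X' \<in> vector_fields atlas" and Y': "Y' \<in> vector_fields atlas"
      and Z': "Z' \<in> vector_fields atlas" and eq: "X' p = X p \<and> Y' p = Y p \<and> Z' p = Z p"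
    define W where "W = curvature D X' Y' Z' - curvature D X Y Z"
    have W: "W \<in> vector_fields atlas"
      unfolding W_def by (intro field_diff curvature_field X Y Z X' Y' Z')
    have "riemann p X' Y' Z' W = riemann p X Y' Z' W"
      using riemann_slot1[OF X' Y' Z' X X W, of p 1 0] eq by simp
    also have "\<dots> = riemann p X Y Z' W"
      using riemann_slot2[OF X Y' Z' Y Y W, of p 1 0] eq by simp
    also have "\<dots> = riemann p X Y Z W"
      using riemann_slot3[OF X Y Z' Z Z W, of p 1 0] eq by simp
    finally have "g p (W p) (W p) = 0"
      using X Y Z X' Y' Z'
      by (simp add: W_def riemann_def metric_simps field_at curvature_field tangent_space_closed)
    then have "W p = 0"
      using metric_zero_iff[OF field_at[OF W]] by blast
    then show "curvature D X' Y' Z' p = curvature D X Y Z p" by (simp add: W_def)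
  qed
qed (use assms in blast)

end

subsection \<open>Contact metric structures\<close>

context almost_contact_metric_manifold
begin

lemma phi_field: "X \<in> vector_fields atlas \<Longrightarrow> app1 \<phi> X \<in> vector_fields atlas"
  using phi_endomorphism unfolding endomorphism_field_def by blast

lemma eta_smooth: "X \<in> vector_fields atlas \<Longrightarrow> app1 \<eta> X \<in> smooth_functions atlas"
  using eta_form unfolding one_form_def by blast

lemma phi_tangent: "u \<in> tangent_space atlas p \<Longrightarrow> \<phi> p u \<in> tangent_space atlas p"
  using phi_endomorphism unfolding endomorphism_field_def linear_between_def by blast

lemma phi_linear:
  assumes "u \<in> tangent_space atlas p"
  shows "v \<in> tangent_space atlas p \<Longrightarrow> \<phi> p (u + v) = \<phi> p u + \<phi> p v"
    and "\<phi> p (a *\<^sub>R u) = a *\<^sub>R \<phi> p u"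
    and "\<phi> p (- u) = - \<phi> p u"
    and "v \<in> tangent_space atlas p \<Longrightarrow> \<phi> p (u - v) = \<phi> p u - \<phi> p v"
proof -
  have add: "\<phi> p (u + v) = \<phi> p u + \<phi> p v" if "v \<in> tangent_space atlas p" for v
    using phi_endomorphism assms that unfolding endomorphism_field_def linear_between_def by blast
  have scale: "\<phi> p (a *\<^sub>R u) = a *\<^sub>R \<phi> p u" if "u \<in> tangent_space atlas p" for u a
    using phi_endomorphism that unfolding endomorphism_field_def linear_between_def by blast
  have neg: "\<phi> p (- u) = - \<phi> p u" if "u \<in> tangent_space atlas p" for u
    using scale[OF that, of "- 1"] by simp
  show "v \<in> tangent_space atlas p \<Longrightarrow> \<phi> p (u + v) = \<phi> p u + \<phi> p v" by (rule add)
  show "\<phi> p (a *\<^sub>R u) = a *\<^sub>R \<phi> p u" by (rule scale[OF assms])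
  show "\<phi> p (- u) = - \<phi> p u" by (rule neg[OF assms])
  show "v \<in> tangent_space atlas p \<Longrightarrow> \<phi> p (u - v) = \<phi> p u - \<phi> p v"
    using add[of "- v"] neg[of v] by (simp add: tangent_space_closed)
qed

lemma eta_linear:
  assumes "u \<in> tangent_space atlas p"
  shows "v \<in> tangent_space atlas p \<Longrightarrow> \<eta> p (u + v) = \<eta> p u + \<eta> p v"
    and "\<eta> p (a *\<^sub>R u) = a * \<eta> p u"
    and "\<eta> p (- u) = - \<eta> p u"
    and "v \<in> tangent_space atlas p \<Longrightarrow> \<eta> p (u - v) = \<eta> p u - \<eta> p v"
proof -
  have add: "\<eta> p (u + v) = \<eta> p u + \<eta> p v" if "v \<in> tangent_space atlas p" for v
    using eta_form assms that unfolding one_form_def linear_between_def by blast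
  have scale: "\<eta> p (a *\<^sub>R u) = a * \<eta> p u" if "u \<in> tangent_space atlas p" for u a
    using eta_form that unfolding one_form_def linear_between_def real_scaleR_def by blast
  have neg: "\<eta> p (- u) = - \<eta> p u" if "u \<in> tangent_space atlas p" for u
    using scale[OF that, of "- 1"] by simp
  show "v \<in> tangent_space atlas p \<Longrightarrow> \<eta> p (u + v) = \<eta> p u + \<eta> p v" by (rule add)
  show "\<eta> p (a *\<^sub>R u) = a * \<eta> p u" by (rule scale[OF assms])
  show "\<eta> p (- u) = - \<eta> p u" by (rule neg[OF assms])
  show "v \<in> tangent_space atlas p \<Longrightarrow> \<eta> p (u - v) = \<eta> p u - \<eta> p v"
    using add[of "- v"] neg[of v] by (simp add: tangent_space_closed)
qed

lemma eta_xi_at: "\<eta> p (\<xi> p) = 1"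
  using fun_cong[OF eta_xi, of p] by (simp add: app1_def)

lemma xi_nonzero: "\<xi> p \<noteq> 0"
  using eta_xi_at[of p] eta_linear(2)[OF field_at[OF xi_field], of p 0] by auto

lemma phi_phi_at:
  "X \<in> vector_fields atlas \<Longrightarrow> \<phi> p (\<phi> p (X p)) = - X p + \<eta> p (X p) *\<^sub>R \<xi> p"
  using fun_cong[OF phi_phi, of X p] by (simp add: app1_def field_scale_def)

lemma metric_phi_at:
  "X \<in> vector_fields atlas \<Longrightarrow> Y \<in> vector_fields atlas \<Longrightarrow>
    g p (\<phi> p (X p)) (\<phi> p (Y p)) = g p (X p) (Y p) - \<eta> p (X p) * \<eta> p (Y p)"
  using fun_cong[OF metric_phi, of X Y p] by (simp add: app1_def app2_def)

text \<open>The square of \<phi> annihilates \<xi>. Its cube on \<xi> then shows that \<phi>\<xi> is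
  a multiple \<open>?a\<close> of \<xi>, and applying \<phi> again gives \<open>?a\<close> squared
  times \<xi> equal to 0.\<close>

lemma phi_xi: "\<phi> p (\<xi> p) = 0"
proof -
  note T = field_at[OF xi_field, of p]
  let ?a = "\<eta> p (\<phi> p (\<xi> p))"
  have sq: "\<phi> p (\<phi> p (\<xi> p)) = 0"
    by (simp add: phi_phi_at[OF xi_field] eta_xi_at)
  have "\<phi> p (\<phi> p (\<phi> p (\<xi> p))) = - \<phi> p (\<xi> p) + ?a *\<^sub>R \<xi> p"
    using phi_phi_at[OF phi_field[OF xi_field], of p] by (simp add: app1_def)
  moreover have "\<phi> p 0 = 0" using phi_linear(2)[OF T, of 0] by simp
  ultimately have eq: "\<phi> p (\<xi> p) = ?a *\<^sub>R \<xi> p" by (simp add: sq)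
  then have "\<phi> p (\<phi> p (\<xi> p)) = ?a *\<^sub>R \<phi> p (\<xi> p)"
    using phi_linear(2)[OF T, of ?a] by simp
  then have "?a *\<^sub>R ?a *\<^sub>R \<xi> p = 0" using sq eq by simp
  then have "?a = 0" using xi_nonzero[of p] by simp
  then show ?thesis using eq by simp
qed

text \<open>The cube of \<phi> on X, computed as \<phi> after its square and as the square after
  \<phi>, differs by \<eta>(\<phi>X)\<xi>.\<close>

lemma eta_phi:
  assumes "X \<in> vector_fields atlas" shows "\<eta> p (\<phi> p (X p)) = 0"
proof -
  note T = field_at[OF assms, of p] field_at[OF xi_field, of p]
  have "\<phi> p (- X p + \<eta> p (X p) *\<^sub>R \<xi> p) = - \<phi> p (X p)"
    using T by (simp add: phi_linear tangent_space_closed phi_xi)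
  moreover have "\<phi> p (\<phi> p (\<phi> p (X p))) = - \<phi> p (X p) + \<eta> p (\<phi> p (X p)) *\<^sub>R \<xi> p"
    using phi_phi_at[OF phi_field[OF assms], of p] by (simp add: app1_def)
  ultimately show ?thesis
    using xi_nonzero[of p] by (simp add: phi_phi_at[OF assms])
qed

lemma metric_xi:
  assumes "X \<in> vector_fields atlas" shows "g p (X p) (\<xi> p) = \<eta> p (X p)"
  using metric_phi_at[OF assms xi_field, of p]
  by (simp add: phi_xi eta_xi_at metric_simps phi_tangent field_at[OF assms])

lemma metric_self_phi:
  assumes "X \<in> vector_fields atlas" shows "g p (X p) (\<phi> p (X p)) = 0"
proof -
  note T = field_at[OF assms, of p] field_at[OF xi_field, of p]
  have P: "\<phi> p (X p) \<in> tangent_space atlas p" by (rule phi_tangent[OF T(1)])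
  have "g p (\<phi> p (X p)) (\<phi> p (\<phi> p (X p))) = g p (X p) (\<phi> p (X p))"
    using metric_phi_at[OF assms phi_field[OF assms], of p] by (simp add: app1_def eta_phi[OF assms])
  moreover have "g p (\<phi> p (X p)) (\<xi> p) = 0"
    using metric_xi[OF phi_field[OF assms], of p] by (simp add: app1_def eta_phi[OF assms])
  ultimately have "- g p (\<phi> p (X p)) (X p) = g p (X p) (\<phi> p (X p))"
    using T P by (simp add: phi_phi_at[OF assms] metric_simps tangent_space_closed)
  then show ?thesis using metric_sym[OF T(1) P] by simp
qed

definition horizontal :: "'a vector_field \<Rightarrow> 'a vector_field" where
  "horizontal X = X - app1 \<eta> X \<odot> \<xi>"

lemma horizontal_field: "X \<in> vector_fields atlas \<Longrightarrow> horizontal X \<in> vector_fields atlas"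
  unfolding horizontal_def by (intro field_closed eta_smooth xi_field)

lemma horizontal_at: "horizontal X p = X p - \<eta> p (X p) *\<^sub>R \<xi> p"
  by (simp add: horizontal_def field_scale_def app1_def)

lemma eta_horizontal: "X \<in> vector_fields atlas \<Longrightarrow> \<eta> p (horizontal X p) = 0"
  by (simp add: horizontal_at eta_linear field_at xi_field tangent_space_closed eta_xi_at)

lemma metric_horizontal:
  assumes "X \<in> vector_fields atlas" "Y \<in> vector_fields atlas"
  shows "g p (horizontal X p) (horizontal Y p) = g p (X p) (Y p) - \<eta> p (X p) * \<eta> p (Y p)"
  using assms metric_xi[OF assms(1), of p] metric_xi[OF assms(2), of p] metric_xi[OF xi_field, of p]
    metric_sym[OF field_at[OF assms(2)] field_at[OF xi_field], of p]
  by (simp add: horizontal_at metric_simps field_at xi_field tangent_space_closed eta_xi_at)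

text \<open>Both sides vanish where \<open>E\<close> does, so this holds globally with smooth coefficients.\<close>

lemma frame_expansion:
  assumes dim: "DIM('b) = 3" and E: "E \<in> vector_fields atlas" and etaE: "\<And>q. \<eta> q (E q) = 0"
    and W: "W \<in> vector_fields atlas"
  shows "app2 g E E \<odot> W = (app2 g E E * app1 \<eta> W) \<odot> \<xi> + app2 g W E \<odot> E +
    app2 g W (app1 \<phi> E) \<odot> app1 \<phi> E"
proof
  fix q
  let ?s = "g q (E q) (E q)" and ?P = "\<phi> q (E q)"
  note T = field_at[OF E, of q] field_at[OF W, of q] field_at[OF xi_field, of q]
    phi_tangent[OF field_at[OF E, of q]]
  \<comment> \<open>\<phi> preserves the length of E, so \<phi>E vanishes exactly where E does and
    the single factor \<open>?s\<close> clears both denominators.\<close>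
  have PP: "g q ?P ?P = ?s" using metric_phi_at[OF E E, of q] by (simp add: etaE)
  have "?s *\<^sub>R W q = (?s * \<eta> q (W q)) *\<^sub>R \<xi> q + g q (W q) (E q) *\<^sub>R E q + g q (W q) ?P *\<^sub>R ?P"
  proof (cases "E q = 0")
    case True
    then show ?thesis using T PP metric_zero_iff[OF T(4)] by (simp add: metric_simps)
  next
    case False
    then have s: "?s \<noteq> 0" using metric_zero_iff[OF T(1)] by blast
    then have P: "?P \<noteq> 0" using PP metric_zero_iff[OF T(4)] by metis
    have xE: "g q (\<xi> q) (E q) = 0"
      using metric_xi[OF E, of q] metric_sym[OF T(1,3)] by (simp add: etaE)
    have xP: "g q (\<xi> q) ?P = 0"
      using metric_xi[OF phi_field[OF E], of q] metric_sym[OF T(4,3)]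
      by (simp add: app1_def eta_phi[OF E])
    have xx: "g q (\<xi> q) (\<xi> q) = 1" using metric_xi[OF xi_field, of q] by (simp add: eta_xi_at)
    have "W q = (\<eta> q (W q)) *\<^sub>R \<xi> q + (g q (W q) (E q) / ?s) *\<^sub>R E q + (g q (W q) ?P / ?s) *\<^sub>R ?P"
      using orthogonal_expansion_dim3[OF dim T(3,1,4,2) xi_nonzero False P xE xP metric_self_phi[OF E]]
      by (simp add: xx PP metric_xi[OF W])
    then have "?s *\<^sub>R W q = ?s *\<^sub>R ((\<eta> q (W q)) *\<^sub>R \<xi> q + (g q (W q) (E q) / ?s) *\<^sub>R E q +
        (g q (W q) ?P / ?s) *\<^sub>R ?P)" by (rule arg_cong)
    then show ?thesis using s by (simp add: scaleR_add_right)
  qed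
  then show "(app2 g E E \<odot> W) q = ((app2 g E E * app1 \<eta> W) \<odot> \<xi> + app2 g W E \<odot> E +
    app2 g W (app1 \<phi> E) \<odot> app1 \<phi> E) q"
    by (simp add: field_scale_def app1_def app2_def)
qed

end

context contact_metric_manifold
begin

abbreviation (input) h :: "'a vector_field \<Rightarrow> 'a vector_field" where "h \<equiv> h_field \<phi> \<xi>"

lemma h_field: "X \<in> vector_fields atlas \<Longrightarrow> h X \<in> vector_fields atlas"
  unfolding h_field_def lie_deriv_endo_def by (intro field_closed phi_field xi_field)

lemma h_at: "h X p = (1/2) *\<^sub>R (lie_bracket \<xi> (app1 \<phi> X) p - \<phi> p (lie_bracket \<xi> X p))"
  by (simp add: h_field_def lie_deriv_endo_def app1_def)

text \<open>d\<eta>(\<xi>,X) equals g(\<xi>,\<phi>X), which is \<eta>(\<phi>X) = 0, and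
  \<eta>(\<xi>) is constant; two terms of the formula for d\<eta> remain.\<close>

lemma eta_lie_bracket_xi:
  assumes "X \<in> vector_fields atlas"
  shows "\<eta> p (lie_bracket \<xi> X p) = field_deriv \<xi> (app1 \<eta> X) p"
proof -
  have "ext_deriv \<eta> \<xi> X p = 0"
    using fun_cong[OF contact[OF xi_field assms], of p] metric_xi[OF phi_field[OF assms], of p]
      metric_sym[OF phi_tangent[OF field_at[OF assms]] field_at[OF xi_field], of p]
    by (simp add: app1_def app2_def eta_phi[OF assms])
  moreover have "field_deriv X (app1 \<eta> \<xi>) p = 0"
    using tangent_one[OF field_at[OF assms]] by (simp add: eta_xi field_deriv_def)
  ultimately show ?thesis by (simp add: ext_deriv_def app1_def)
qed

text \<open>Of the two terms of h, one is \<xi> differentiating \<eta>(\<phi>X), which is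
  identically 0; the other lies in the image of \<phi>.\<close>

lemma eta_h:
  assumes "X \<in> vector_fields atlas" shows "\<eta> p (h X p) = 0"
proof -
  note F = xi_field phi_field[OF assms] lie_bracket_field[OF xi_field assms]
    lie_bracket_field[OF xi_field phi_field[OF assms]]
  have "app1 \<eta> (app1 \<phi> X) = 0"
    using eta_phi[OF assms] by (simp add: fun_eq_iff app1_def)
  then have "\<eta> p (lie_bracket \<xi> (app1 \<phi> X) p) = 0"
    using eta_lie_bracket_xi[OF F(2), of p] tangent_zero[OF field_at[OF xi_field]]
    by (simp add: field_deriv_def)
  then show ?thesis
    using F by (simp add: h_at eta_linear tangent_space_closed field_at phi_tangent eta_phi)
qed

lemma h_add:
  assumes X: "X \<in> vector_fields atlas" and Y: "Y \<in> vector_fields atlas"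
  shows "h (X + Y) = h X + h Y"
proof
  fix p
  have "app1 \<phi> (X + Y) = app1 \<phi> X + app1 \<phi> Y"
    using assms by (simp add: fun_eq_iff app1_def phi_linear field_at)
  then show "h (X + Y) p = (h X + h Y) p"
    using assms
    by (simp add: h_at lie_bracket_add_right xi_field phi_field phi_linear field_at lie_bracket_field)
       (simp add: algebra_simps)
qed

text \<open>The terms \<xi>(s)\<phi>X produced by the two brackets cancel. With \<open>h_add\<close>
  this lets \<open>h\<close> act on the expansion of a field in \<xi>, E, \<phi>E.\<close>

lemma h_scale:
  assumes s: "s \<in> smooth_functions atlas" and X: "X \<in> vector_fields atlas"
  shows "h (s \<odot> X) = s \<odot> h X"
proof
  fix p
  note F = X xi_field phi_field[OF X] lie_bracket_field[OF xi_field X]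
    lie_bracket_field[OF xi_field phi_field[OF X]]
  have "app1 \<phi> (s \<odot> X) = s \<odot> app1 \<phi> X"
    using X by (simp add: fun_eq_iff app1_def phi_linear field_at field_scale_def)
  then show "h (s \<odot> X) p = (s \<odot> h X) p"
    using F s
    by (simp add: h_at lie_bracket_scale_right field_scale_apply
        phi_linear field_at tangent_space_closed)
       (simp add: app1_def algebra_simps)
qed

lemma h_xi: "h \<xi> = 0"
proof
  fix p
  have "app1 \<phi> \<xi> = 0" by (simp add: fun_eq_iff app1_def phi_xi)
  moreover have "lie_bracket \<xi> 0 p = 0"
    using lie_bracket_uminus_right[OF xi_field field_zero[OF xi_field]]
      lie_bracket_add_right[OF xi_field field_zero[OF xi_field] field_zero[OF xi_field]] by simp
  moreover have "\<phi> p 0 = 0"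
    using phi_linear(2)[OF field_at[OF xi_field], of p 0] by simp
  ultimately show "h \<xi> p = 0 p"
    by (simp add: h_at lie_bracket_self)
qed

text \<open>This uses \<open>\<eta>([\<xi>, X]) = \<xi> \<eta>(X)\<close>, which is the contact condition for \<open>\<xi>\<close> and \<open>X\<close>.\<close>

lemma h_phi:
  assumes X: "X \<in> vector_fields atlas"
  shows "h (app1 \<phi> X) = - app1 \<phi> (h X)"
proof
  fix p
  note F = X xi_field phi_field[OF X] lie_bracket_field[OF xi_field X]
    lie_bracket_field[OF xi_field phi_field[OF X]]
  have "lie_bracket \<xi> (app1 \<phi> (app1 \<phi> X)) p =
      - lie_bracket \<xi> X p + field_deriv \<xi> (app1 \<eta> X) p *\<^sub>R \<xi> p"
    using F by (simp add: phi_phi lie_bracket_add_right field_closed eta_smooth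
        lie_bracket_uminus_right lie_bracket_scale_right lie_bracket_self field_scale_apply
        del: uminus_add_conv_diff)
  also have "\<dots> = \<phi> p (\<phi> p (lie_bracket \<xi> X p))"
    by (simp add: phi_phi_at[OF F(4)] eta_lie_bracket_xi[OF X])
  finally show "h (app1 \<phi> X) p = (- app1 \<phi> (h X)) p"
    using F by (simp add: h_at app1_def[of \<phi> "h X"] phi_linear tangent_space_closed field_at phi_tangent)
      (simp add: algebra_simps)
qed

end

subsection \<open>Curvature in dimension three\<close>

context kmn_contact_metric_manifold
begin

lemma riemann_xi:
  assumes X: "X \<in> vector_fields atlas" and Y: "Y \<in> vector_fields atlas"
    and T: "T \<in> vector_fields atlas"
  shows "riemann p X Y \<xi> T =
    \<kappa> p * (\<eta> p (Y p) * g p (X p) (T p) - \<eta> p (X p) * g p (Y p) (T p)) +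
    \<mu> p * (\<eta> p (Y p) * g p (h X p) (T p) - \<eta> p (X p) * g p (h Y p) (T p)) +
    \<nu> p * (\<eta> p (Y p) * g p (\<phi> p (h X p)) (T p) - \<eta> p (X p) * g p (\<phi> p (h Y p)) (T p))"
  using assms
  by (simp add: riemann_def curvature_xi field_scale_apply app1_def metric_simps field_at h_field
      phi_tangent tangent_space_closed)

text \<open>Each argument is split into its \<xi>-component and its horizontal part, the last two
  first. Once these two are horizontal, a \<xi> in the first pair contributes nothing.\<close>

lemma riemann_decomposition:
  assumes X: "X \<in> vector_fields atlas" and Y: "Y \<in> vector_fields atlas"
    and Z: "Z \<in> vector_fields atlas" and W: "W \<in> vector_fields atlas"
  shows "riemann p X Y Z W =
    \<eta> p (Z p) * riemann p X Y \<xi> W - \<eta> p (W p) * riemann p X Y \<xi> Z +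
    riemann p (horizontal X) (horizontal Y) (horizontal Z) (horizontal W)"
proof -
  have split: "A p = \<eta> p (A p) *\<^sub>R \<xi> p + 1 *\<^sub>R horizontal A p" for A
    by (simp add: horizontal_at)
  note hor = horizontal_field
  note H = hor[OF X] hor[OF Y] hor[OF Z] hor[OF W]
  \<comment> \<open>Pair symmetry turns this into R(X,Y)\<xi> with horizontal X and Y, and each term
    of the formula for it carries an \<eta> of one of them.\<close>
  have xi0: "riemann p A \<xi> (horizontal Z) (horizontal W) = 0"
    "riemann p \<xi> A (horizontal Z) (horizontal W) = 0" if A: "A \<in> vector_fields atlas" for A
  proof -
    have "riemann p \<xi> A (horizontal Z) (horizontal W) = riemann p (horizontal Z) (horizontal W) \<xi> A"
      by (intro riemann_pair_sym H xi_field A)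
    then show "riemann p \<xi> A (horizontal Z) (horizontal W) = 0"
      by (simp add: riemann_xi H A eta_horizontal Z W)
    then show "riemann p A \<xi> (horizontal Z) (horizontal W) = 0"
      using riemann_antisym12[OF xi_field A H(3,4)] by simp
  qed
  have "riemann p X Y \<xi> \<xi> = 0"
    using riemann_antisym34[OF X Y xi_field xi_field, of p] by simp
  moreover have "riemann p X Y Z W = \<eta> p (Z p) * riemann p X Y \<xi> W + 1 * riemann p X Y (horizontal Z) W"
    by (intro riemann_slot3 split X Y Z W xi_field H)
  moreover have "riemann p X Y (horizontal Z) W =
      \<eta> p (W p) * riemann p X Y (horizontal Z) \<xi> + 1 * riemann p X Y (horizontal Z) (horizontal W)"
    by (intro riemann_slot4 split X Y Z W xi_field H)
  moreover have "riemann p X Y (horizontal Z) \<xi> = - riemann p X Y \<xi> (horizontal Z)"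
    by (intro riemann_antisym34 X Y xi_field H)
  moreover have "riemann p X Y \<xi> Z = \<eta> p (Z p) * riemann p X Y \<xi> \<xi> + 1 * riemann p X Y \<xi> (horizontal Z)"
    by (intro riemann_slot4 split X Y Z xi_field H)
  moreover have "riemann p X Y (horizontal Z) (horizontal W) =
      \<eta> p (X p) * riemann p \<xi> Y (horizontal Z) (horizontal W) +
      1 * riemann p (horizontal X) Y (horizontal Z) (horizontal W)"
    by (intro riemann_slot1 split X Y xi_field H)
  moreover have "riemann p (horizontal X) Y (horizontal Z) (horizontal W) =
      \<eta> p (Y p) * riemann p (horizontal X) \<xi> (horizontal Z) (horizontal W) +
      1 * riemann p (horizontal X) (horizontal Y) (horizontal Z) (horizontal W)"
    by (intro riemann_slot2 split X Y xi_field H)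
  ultimately show ?thesis
    by (simp add: xi0[OF Y] xi0[OF H(1)])
qed

text \<open>If u = aE + b\<phi>E then \<phi>u = -bE + a\<phi>E, so both determinants in
  \<open>riemann_plane\<close> are, up to sign, the square sum of a and b. This is 1/g(E,E) for
  every unit u, hence the independence of u and the squared factor.\<close>

lemma phi_sectional_curvature_frame:
  assumes dim: "DIM('b) = 3" and E: "E \<in> vector_fields atlas" and etaE: "\<And>q. \<eta> q (E q) = 0"
    and E0: "E p \<noteq> 0"
  shows "riemann p E (app1 \<phi> E) (app1 \<phi> E) E =
    (g p (E p) (E p))\<^sup>2 * phi_sectional_curvature atlas g \<phi> \<xi> D p"
proof -
  define P where "P = app1 \<phi> E"
  define s where "s = g p (E p) (E p)"
  define c where "c = riemann p E P P E / s\<^sup>2"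
  have P: "P \<in> vector_fields atlas" unfolding P_def by (rule phi_field[OF E])
  have Pp: "P p = \<phi> p (E p)" by (simp add: P_def app1_def)
  note T = field_at[OF E, of p] field_at[OF P, of p] field_at[OF xi_field, of p]
  have s: "s > 0" unfolding s_def by (rule metric_pos[OF T(1) E0])
  have PP: "g p (P p) (P p) = s" using metric_phi_at[OF E E, of p] by (simp add: etaE Pp s_def)
  have EP: "g p (E p) (P p) = 0" using metric_self_phi[OF E, of p] by (simp add: Pp)
  have PE: "g p (P p) (E p) = 0" using EP metric_sym[OF T(1,2)] by simp
  have xE: "g p (\<xi> p) (E p) = 0"
    using metric_xi[OF E, of p] metric_sym[OF T(1,3)] by (simp add: etaE)
  have xP: "g p (\<xi> p) (P p) = 0"
    using metric_xi[OF P, of p] metric_sym[OF T(2,3)] by (simp add: Pp eta_phi[OF E])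
  have P0: "P p \<noteq> 0" using metric_zero_iff[OF T(2)] PP s by force
  have "phi_sectional_curvature atlas g \<phi> \<xi> D p = c"
    unfolding phi_sectional_curvature_def
  proof (rule the_equality)
    show "\<forall>u\<in>tangent_space atlas p. g p u u = 1 \<and> g p u (\<xi> p) = 0 \<longrightarrow>
        g p (curvature_at atlas D p u (\<phi> p u) (\<phi> p u)) u = c"
    proof (intro ballI impI, elim conjE)
      fix u assume u: "u \<in> tangent_space atlas p" and uu: "g p u u = 1" and ux: "g p u (\<xi> p) = 0"
      \<comment> \<open>These are numbers, so \<open>U\<close> is a field that extends
        \<open>u\<close>.\<close>
      define a b where "a = g p u (E p) / s" and "b = g p u (P p) / s"
      define U where "U = a *\<^sub>R E + b *\<^sub>R P"
      have U: "U \<in> vector_fields atlas" unfolding U_def by (intro field_closed E P)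
      have pU: "app1 \<phi> U \<in> vector_fields atlas" by (rule phi_field[OF U])
      have Up: "U p = a *\<^sub>R E p + b *\<^sub>R P p" by (simp add: U_def)
      have u_eq: "u = U p"
        using orthogonal_expansion_dim3[OF dim T(3,1,2) u xi_nonzero E0 P0 xE xP EP]
        by (simp add: ux Up a_def b_def PP s_def)
      have "\<phi> p (P p) = - E p"
        using phi_phi_at[OF E, of p] by (simp add: Pp etaE)
      then have pUp: "app1 \<phi> U p = (- b) *\<^sub>R E p + a *\<^sub>R P p"
        using T by (simp add: app1_def Up phi_linear tangent_space_closed Pp)
      have "1 = g p (U p) (U p)" using uu u_eq by simp
      also have "\<dots> = (a\<^sup>2 + b\<^sup>2) * s"
        using T by (simp add: Up metric_simps tangent_space_closed EP PE PP s_def[symmetric]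
            power2_eq_square algebra_simps)
      finally have ab: "a\<^sup>2 + b\<^sup>2 = 1 / s" using s by (simp add: field_simps)
      have "g p (curvature_at atlas D p u (\<phi> p u) (\<phi> p u)) u = riemann p U (app1 \<phi> U) (app1 \<phi> U) U"
        using curvature_at_eq[OF U pU pU, of p] u_eq by (simp add: riemann_def app1_def)
      also have "\<dots> = - ((a * a - b * (- b)) * ((- b) * b - a * a) * riemann p E P P E)"
        by (rule riemann_plane[OF U pU pU E P U Up pUp pUp Up])
      also have "\<dots> = (a\<^sup>2 + b\<^sup>2)\<^sup>2 * riemann p E P P E"
        by (simp add: power2_eq_square algebra_simps)
      also have "\<dots> = c" by (simp add: ab c_def power_divide)
      finally show "g p (curvature_at atlas D p u (\<phi> p u) (\<phi> p u)) u = c" .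
    qed
    \<comment> \<open>Uniqueness: the condition on \<open>c'\<close> is not vacuous, since
      normalising \<open>E p\<close> gives an admissible vector.\<close>
    fix c'
    assume c': "\<forall>u\<in>tangent_space atlas p. g p u u = 1 \<and> g p u (\<xi> p) = 0 \<longrightarrow>
        g p (curvature_at atlas D p u (\<phi> p u) (\<phi> p u)) u = c'"
    define u where "u = (1 / sqrt s) *\<^sub>R E p"
    have u: "u \<in> tangent_space atlas p" "g p u u = 1" "g p u (\<xi> p) = 0"
      using T s metric_xi[OF E, of p]
      by (simp_all add: u_def tangent_space_closed metric_simps etaE flip: s_def)
    show "c' = c"
    proof -
      define U where "U = (1 / sqrt s) *\<^sub>R E"
      have U: "U \<in> vector_fields atlas" unfolding U_def by (intro field_closed E)
      have pU: "app1 \<phi> U \<in> vector_fields atlas" by (rule phi_field[OF U])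
      have Up: "U p = (1 / sqrt s) *\<^sub>R E p + 0 *\<^sub>R P p" by (simp add: U_def)
      have pUp: "app1 \<phi> U p = 0 *\<^sub>R E p + (1 / sqrt s) *\<^sub>R P p"
        using T by (simp add: U_def app1_def phi_linear Pp)
      have uU: "u = U p" by (simp add: u_def U_def)
      have "c' = g p (curvature_at atlas D p u (\<phi> p u) (\<phi> p u)) u"
        using c' u by simp
      also have "\<dots> = riemann p U (app1 \<phi> U) (app1 \<phi> U) U"
        using curvature_at_eq[OF U pU pU, of p] uU by (simp add: riemann_def app1_def)
      also have "\<dots> = - ((1 / sqrt s * (1 / sqrt s) - 0 * 0) * (0 * 0 - 1 / sqrt s * (1 / sqrt s)) *
          riemann p E P P E)"
        by (rule riemann_plane[OF U pU pU E P U Up pUp pUp Up])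
      also have "\<dots> = c" using s by (simp add: c_def power2_eq_square)
      finally show "c' = c" .
    qed
  qed
  then show ?thesis using s by (simp add: c_def P_def[symmetric] s_def[symmetric])
qed

text \<open>
  In the basis \<open>E, \<phi>E\<close> of the horizontal plane, \<open>h\<close> anticommutes with \<open>\<phi>\<close> and hence has a symmetric
  traceless matrix. A horizontal vector at \<open>p\<close> need not extend to a vector field
  a priori: if none does, everything vanishes with \<open>s = 0\<close>.
\<close>

lemma horizontal_coordinates:
  assumes dim: "DIM('b) = 3"
  obtains s a b :: real and x1 x2 :: "'a vector_field \<Rightarrow> real" where
    "\<And>A B. A \<in> vector_fields atlas \<Longrightarrow> B \<in> vector_fields atlas \<Longrightarrow>
      g p (A p) (B p) = \<eta> p (A p) * \<eta> p (B p) + s * (x1 A * x1 B + x2 A * x2 B)"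
    "\<And>A B. A \<in> vector_fields atlas \<Longrightarrow> B \<in> vector_fields atlas \<Longrightarrow>
      g p (h A p) (B p) = s * ((a * x1 A + b * x2 A) * x1 B + (b * x1 A - a * x2 A) * x2 B)"
    "\<And>A B. A \<in> vector_fields atlas \<Longrightarrow> B \<in> vector_fields atlas \<Longrightarrow>
      g p (\<phi> p (h A p)) (B p) = s * ((a * x2 A - b * x1 A) * x1 B + (a * x1 A + b * x2 A) * x2 B)"
    "\<And>X Y Z W. X \<in> vector_fields atlas \<Longrightarrow> Y \<in> vector_fields atlas \<Longrightarrow> Z \<in> vector_fields atlas \<Longrightarrow>
      W \<in> vector_fields atlas \<Longrightarrow>
      riemann p (horizontal X) (horizontal Y) (horizontal Z) (horizontal W) =
      - (s\<^sup>2 * phi_sectional_curvature atlas g \<phi> \<xi> D p *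
        (x1 X * x2 Y - x2 X * x1 Y) * (x1 Z * x2 W - x2 Z * x1 W))"
proof (cases "\<exists>X\<in>vector_fields atlas. horizontal X p \<noteq> 0")
  case False
  then have zero: "horizontal A p = 0" if "A \<in> vector_fields atlas" for A using that by blast
  have g: "g p (A p) (B p) = \<eta> p (A p) * \<eta> p (B p)"
    if "A \<in> vector_fields atlas" "B \<in> vector_fields atlas" for A B
    using metric_horizontal[OF that, of p] metric_linear_left(5)[OF field_at[OF horizontal_field[OF that(2)]], of p]
    by (simp add: zero[OF that(1)])
  have "g p (h A p) (B p) = 0" "g p (\<phi> p (h A p)) (B p) = 0"
    if "A \<in> vector_fields atlas" "B \<in> vector_fields atlas" for A B
    using g[OF h_field[OF that(1)] that(2)] g[OF phi_field[OF h_field[OF that(1)]] that(2)]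
    by (simp_all add: eta_h[OF that(1)] eta_phi[OF h_field[OF that(1)]] app1_def)
  moreover have "riemann p (horizontal X) (horizontal Y) (horizontal Z) (horizontal W) = 0"
    if "X \<in> vector_fields atlas" "Y \<in> vector_fields atlas" "Z \<in> vector_fields atlas"
      "W \<in> vector_fields atlas" for X Y Z W
    using that metric_linear_right(5)[OF field_at[OF curvature_field]]
    by (simp add: riemann_def zero horizontal_field)
  ultimately show ?thesis
    using g by (intro that[of 0 "\<lambda>_. 0" "\<lambda>_. 0" 0 0]) simp_all
next
  case True
  then obtain E0 where E0: "E0 \<in> vector_fields atlas" "horizontal E0 p \<noteq> 0" by blast
  define E where "E = horizontal E0"
  define P where "P = app1 \<phi> E"
  define s where "s = g p (E p) (E p)"
  have E: "E \<in> vector_fields atlas" unfolding E_def by (rule horizontal_field[OF E0(1)])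
  have P: "P \<in> vector_fields atlas" unfolding P_def by (rule phi_field[OF E])
  have Pp: "P p = \<phi> p (E p)" by (simp add: P_def app1_def)
  have Ep: "E p \<noteq> 0" using E0(2) by (simp add: E_def)
  have etaE: "\<eta> q (E q) = 0" for q unfolding E_def by (rule eta_horizontal[OF E0(1)])
  note T = field_at[OF E, of p] field_at[OF P, of p] field_at[OF xi_field, of p]
  have s: "s > 0" unfolding s_def by (rule metric_pos[OF T(1) Ep])
  define x1 x2 where "x1 A = g p (A p) (E p) / s" and "x2 A = g p (A p) (P p) / s" for A
  \<comment> \<open>The first column of the matrix of h in the basis E, \<phi>E.\<close>
  define a b where "a = x1 (h E)" and "b = x2 (h E)"
  note frame = frame_expansion[OF dim E etaE]
  have exp: "A p = \<eta> p (A p) *\<^sub>R \<xi> p + (x1 A *\<^sub>R E p + x2 A *\<^sub>R P p)"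
    if A: "A \<in> vector_fields atlas" for A
  proof -
    have "s *\<^sub>R A p = s *\<^sub>R (\<eta> p (A p) *\<^sub>R \<xi> p + (x1 A *\<^sub>R E p + x2 A *\<^sub>R P p))"
      using fun_cong[OF frame[OF A], of p] s
      by (simp add: field_scale_apply app1_def app2_def x1_def x2_def Pp scaleR_add_right flip: s_def)
    then show ?thesis using s by (metis less_irrefl scaleR_cancel_left)
  qed
  have gB: "g p (E p) (B p) = s * x1 B" "g p (P p) (B p) = s * x2 B"
    if "B \<in> vector_fields atlas" for B
    using s metric_sym[OF T(1) field_at[OF that]] metric_sym[OF T(2) field_at[OF that]]
    by (simp_all add: x1_def x2_def)
  have xiB: "g p (\<xi> p) (B p) = \<eta> p (B p)" if "B \<in> vector_fields atlas" for B
    using metric_xi[OF that, of p] metric_sym[OF T(3) field_at[OF that]] by simp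
  have hE: "h E p = a *\<^sub>R E p + b *\<^sub>R P p"
    using exp[OF h_field[OF E]] by (simp add: eta_h[OF E] a_def b_def)
  have phiP: "\<phi> p (P p) = - E p"
    using phi_phi_at[OF E, of p] by (simp add: Pp etaE)
  have phi_comb: "\<phi> p (u *\<^sub>R E p + v *\<^sub>R P p) = u *\<^sub>R P p - v *\<^sub>R E p" for u v
    using T by (simp add: phi_linear tangent_space_closed Pp[symmetric] phiP)
  \<comment> \<open>Anticommutation yields the second column from the first; symmetry and vanishing
    trace can be read off.\<close>
  have hP: "h P p = b *\<^sub>R E p - a *\<^sub>R P p"
    using fun_cong[OF h_phi[OF E, folded P_def], of p] by (simp add: app1_def hE phi_comb)
  have hA: "h A p = (a * x1 A + b * x2 A) *\<^sub>R E p + (b * x1 A - a * x2 A) *\<^sub>R P p"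
    if A: "A \<in> vector_fields atlas" for A
  proof -
    \<comment> \<open>The factor g(E,E) moves inside \<open>h\<close> so that the expansion with
      smooth coefficients applies; it is cancelled below, at \<open>p\<close>, where it equals
      \<open>s > 0\<close>.\<close>
    have "app2 g E E \<odot> h A = h (app2 g E E \<odot> A)"
      by (intro h_scale[symmetric] A metric_smooth E)
    also have "\<dots> = (app2 g E E * app1 \<eta> A) \<odot> 0 + app2 g A E \<odot> h E + app2 g A P \<odot> h P"
      unfolding frame[OF A] P_def[symmetric] using A E P
      by (simp add: h_add h_scale metric_smooth eta_smooth smooth_mult field_closed xi_field h_xi)
    finally have eq: "app2 g E E \<odot> h A =
        (app2 g E E * app1 \<eta> A) \<odot> 0 + app2 g A E \<odot> h E + app2 g A P \<odot> h P" .
    have "s *\<^sub>R h A p = s *\<^sub>R (x1 A *\<^sub>R h E p + x2 A *\<^sub>R h P p)"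
      using fun_cong[OF eq, of p] s
      by (simp add: field_scale_apply app2_def x1_def x2_def scaleR_add_right flip: s_def)
    then have "h A p = x1 A *\<^sub>R h E p + x2 A *\<^sub>R h P p"
      using s by (metis less_irrefl scaleR_cancel_left)
    then show ?thesis by (simp add: hE hP algebra_simps)
  qed
  show ?thesis
  proof (rule that[of s x1 x2 a b])
    fix A B assume A: "A \<in> vector_fields atlas" and B: "B \<in> vector_fields atlas"
    note TB = field_at[OF B, of p]
    show "g p (A p) (B p) = \<eta> p (A p) * \<eta> p (B p) + s * (x1 A * x1 B + x2 A * x2 B)"
      using T TB by (subst exp[OF A])
        (simp add: metric_simps tangent_space_closed gB[OF B] xiB[OF B] algebra_simps)
    show "g p (h A p) (B p) = s * ((a * x1 A + b * x2 A) * x1 B + (b * x1 A - a * x2 A) * x2 B)"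
      using T TB by (simp add: hA[OF A] metric_simps tangent_space_closed gB[OF B]) (simp add: algebra_simps)
    show "g p (\<phi> p (h A p)) (B p) = s * ((a * x2 A - b * x1 A) * x1 B + (a * x1 A + b * x2 A) * x2 B)"
      using T TB by (simp add: hA[OF A] phi_comb metric_simps tangent_space_closed gB[OF B])
        (simp add: algebra_simps)
  next
    fix X Y Z W
    assume F: "X \<in> vector_fields atlas" "Y \<in> vector_fields atlas" "Z \<in> vector_fields atlas"
      "W \<in> vector_fields atlas"
    have hor: "horizontal A p = x1 A *\<^sub>R E p + x2 A *\<^sub>R P p" if "A \<in> vector_fields atlas" for A
      using exp[OF that] by (simp add: horizontal_at algebra_simps)
    have "riemann p (horizontal X) (horizontal Y) (horizontal Z) (horizontal W) =
        - ((x1 X * x2 Y - x2 X * x1 Y) * (x1 Z * x2 W - x2 Z * x1 W) * riemann p E P P E)"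
      by (intro riemann_plane horizontal_field F E P hor)
    also have "riemann p E P P E = s\<^sup>2 * phi_sectional_curvature atlas g \<phi> \<xi> D p"
      unfolding P_def s_def by (rule phi_sectional_curvature_frame[OF dim E etaE Ep])
    finally show "riemann p (horizontal X) (horizontal Y) (horizontal Z) (horizontal W) =
      - (s\<^sup>2 * phi_sectional_curvature atlas g \<phi> \<xi> D p *
        (x1 X * x2 Y - x2 X * x1 Y) * (x1 Z * x2 W - x2 Z * x1 W))"
      by (simp add: ac_simps)
  qed
qed

theorem curvature_decomposition:
  assumes dim: "DIM('b) = 3"
    and X: "X \<in> vector_fields atlas" and Y: "Y \<in> vector_fields atlas"
    and Z: "Z \<in> vector_fields atlas"
  defines "F \<equiv> phi_sectional_curvature atlas g \<phi> \<xi> D"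
  shows "curvature D X Y Z =
      F \<odot> R1 g X Y Z + (F - \<kappa>) \<odot> R3 g \<xi> \<eta> X Y Z +
      \<mu> \<odot> R4 g \<phi> \<xi> X Y Z + \<nu> \<odot> R7 g \<phi> \<xi> X Y Z"
proof
  fix p
  \<comment> \<open>With the coefficients frozen at \<open>p\<close> this is a vector field, hence
    admissible as fourth argument of \<open>riemann\<close>; only its value at \<open>p\<close>
    matters.\<close>
  define \<Delta> where "\<Delta> = curvature D X Y Z -
    (F p *\<^sub>R R1 g X Y Z + (F p - \<kappa> p) *\<^sub>R R3 g \<xi> \<eta> X Y Z +
      \<mu> p *\<^sub>R R4 g \<phi> \<xi> X Y Z + \<nu> p *\<^sub>R R7 g \<phi> \<xi> X Y Z)"
  have fields: "R1 g X Y Z \<in> vector_fields atlas" "R3 g \<xi> \<eta> X Y Z \<in> vector_fields atlas"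
    "R4 g \<phi> \<xi> X Y Z \<in> vector_fields atlas" "R7 g \<phi> \<xi> X Y Z \<in> vector_fields atlas"
    unfolding R1_def R3_def R4_def R7_def
    by (intro field_closed metric_smooth smooth_mult eta_smooth h_field phi_field xi_field X Y Z)+
  have \<Delta>: "\<Delta> \<in> vector_fields atlas"
    unfolding \<Delta>_def by (intro field_closed fields curvature_field X Y Z)
  obtain s a b x1 x2 where
    g: "\<And>A B. A \<in> vector_fields atlas \<Longrightarrow> B \<in> vector_fields atlas \<Longrightarrow>
      g p (A p) (B p) = \<eta> p (A p) * \<eta> p (B p) + s * (x1 A * x1 B + x2 A * x2 B)"
    and h: "\<And>A B. A \<in> vector_fields atlas \<Longrightarrow> B \<in> vector_fields atlas \<Longrightarrow>
      g p (h A p) (B p) = s * ((a * x1 A + b * x2 A) * x1 B + (b * x1 A - a * x2 A) * x2 B)"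
    and \<phi>h: "\<And>A B. A \<in> vector_fields atlas \<Longrightarrow> B \<in> vector_fields atlas \<Longrightarrow>
      g p (\<phi> p (h A p)) (B p) = s * ((a * x2 A - b * x1 A) * x1 B + (a * x1 A + b * x2 A) * x2 B)"
    and R: "\<And>X Y Z W. X \<in> vector_fields atlas \<Longrightarrow> Y \<in> vector_fields atlas \<Longrightarrow> Z \<in> vector_fields atlas \<Longrightarrow>
      W \<in> vector_fields atlas \<Longrightarrow>
      riemann p (horizontal X) (horizontal Y) (horizontal Z) (horizontal W) =
      - (s\<^sup>2 * F p * (x1 X * x2 Y - x2 X * x1 Y) * (x1 Z * x2 W - x2 Z * x1 W))"
    by (rule horizontal_coordinates[OF dim, of p]) (rule that[unfolded F_def])
  note at = field_at[OF X] field_at[OF Y] field_at[OF Z] field_at[OF \<Delta>] field_at[OF xi_field]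
    field_at[OF h_field[OF X]] field_at[OF h_field[OF Y]] phi_tangent tangent_space_closed
  have xi: "g p (\<xi> p) (\<Delta> p) = \<eta> p (\<Delta> p)"
    using metric_xi[OF \<Delta>, of p] metric_sym[OF at(5,4)] by simp
  have R1: "g p (R1 g X Y Z p) (\<Delta> p) =
      g p (Y p) (Z p) * g p (X p) (\<Delta> p) - g p (X p) (Z p) * g p (Y p) (\<Delta> p)"
    by (simp add: R1_def field_scale_apply app2_def metric_simps at)
  have R3: "g p (R3 g \<xi> \<eta> X Y Z p) (\<Delta> p) =
      \<eta> p (X p) * \<eta> p (Z p) * g p (Y p) (\<Delta> p) - \<eta> p (Y p) * \<eta> p (Z p) * g p (X p) (\<Delta> p) +
      g p (X p) (Z p) * \<eta> p (Y p) * \<eta> p (\<Delta> p) - g p (Y p) (Z p) * \<eta> p (X p) * \<eta> p (\<Delta> p)"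
    by (simp add: R3_def field_scale_apply app1_def app2_def metric_simps at xi)
  have R4: "g p (R4 g \<phi> \<xi> X Y Z p) (\<Delta> p) =
      g p (Y p) (Z p) * g p (h X p) (\<Delta> p) - g p (X p) (Z p) * g p (h Y p) (\<Delta> p) +
      g p (h Y p) (Z p) * g p (X p) (\<Delta> p) - g p (h X p) (Z p) * g p (Y p) (\<Delta> p)"
    by (simp add: R4_def field_scale_apply app2_def metric_simps at)
  have R7: "g p (R7 g \<phi> \<xi> X Y Z p) (\<Delta> p) =
      g p (Y p) (Z p) * g p (\<phi> p (h X p)) (\<Delta> p) - g p (X p) (Z p) * g p (\<phi> p (h Y p)) (\<Delta> p) +
      g p (\<phi> p (h Y p)) (Z p) * g p (X p) (\<Delta> p) - g p (\<phi> p (h X p)) (Z p) * g p (Y p) (\<Delta> p)"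
    by (simp add: R7_def field_scale_apply app1_def app2_def metric_simps at)
  have \<Delta>p: "\<Delta> p = curvature D X Y Z p - (F p *\<^sub>R R1 g X Y Z p +
      (F p - \<kappa> p) *\<^sub>R R3 g \<xi> \<eta> X Y Z p + \<mu> p *\<^sub>R R4 g \<phi> \<xi> X Y Z p +
      \<nu> p *\<^sub>R R7 g \<phi> \<xi> X Y Z p)"
    by (simp add: \<Delta>_def)
  have "g p (\<Delta> p) (\<Delta> p) = riemann p X Y Z \<Delta> -
      (F p * g p (R1 g X Y Z p) (\<Delta> p) + (F p - \<kappa> p) * g p (R3 g \<xi> \<eta> X Y Z p) (\<Delta> p) +
        \<mu> p * g p (R4 g \<phi> \<xi> X Y Z p) (\<Delta> p) + \<nu> p * g p (R7 g \<phi> \<xi> X Y Z p) (\<Delta> p))"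
    using arg_cong[OF \<Delta>p, of "\<lambda>v. g p v (\<Delta> p)"]
    by (simp add: riemann_def metric_linear_left[OF field_at[OF \<Delta>]] field_at curvature_field X Y Z
        fields tangent_space_closed)
  \<comment> \<open>\<open>R1 + R3\<close> is \<open>R1\<close> on horizontal parts and matches the
    term in F; \<open>- R3\<close> is what \<kappa> contributes through R(X,Y)\<xi>. In
    \<open>R4\<close> and \<open>R7\<close> the purely horizontal part is the Kulkarni-Nomizu
    product of the metric with a traceless symmetric form on a plane, which is zero; the terms with
    \<eta> match those in \<mu> and \<nu>.\<close>
  also have "\<dots> = 0"
    unfolding R1 R3 R4 R7 riemann_decomposition[OF X Y Z \<Delta>] riemann_xi[OF X Y \<Delta>]
      riemann_xi[OF X Y Z] R[OF X Y Z \<Delta>]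
    by (simp add: g h \<phi>h X Y Z \<Delta>) (simp add: power2_eq_square algebra_simps)
  finally have "\<Delta> p = 0" using metric_zero_iff[OF field_at[OF \<Delta>]] by blast
  then show "curvature D X Y Z p = (F \<odot> R1 g X Y Z + (F - \<kappa>) \<odot> R3 g \<xi> \<eta> X Y Z +
      \<mu> \<odot> R4 g \<phi> \<xi> X Y Z + \<nu> \<odot> R7 g \<phi> \<xi> X Y Z) p"
    by (simp add: \<Delta>_def field_scale_apply)
qed

end

theorem corollary3p3:
  fixes atlas :: "('a::{t2_space, second_countable_topology}, 'b::euclidean_space) chart set"
    and g :: "'a \<Rightarrow> 'a tangent_vector \<Rightarrow> 'a tangent_vector \<Rightarrow> real"
    and \<phi> :: "'a \<Rightarrow> 'a tangent_vector \<Rightarrow> 'a tangent_vector"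
    and \<xi> :: "'a vector_field"
    and \<eta> :: "'a \<Rightarrow> 'a tangent_vector \<Rightarrow> real"
    and D :: "'a vector_field \<Rightarrow> 'a vector_field \<Rightarrow> 'a vector_field"
    and \<kappa> \<mu> \<nu> F :: "'a \<Rightarrow> real"
  assumes "kmn_contact_metric_manifold atlas g \<phi> \<xi> \<eta> D \<kappa> \<mu> \<nu>"
    and "DIM('b) = 3"
    and "\<forall>p. \<kappa> p < 1"
    and "F = phi_sectional_curvature atlas g \<phi> \<xi> D"
  shows "\<forall>X\<in>vector_fields atlas. \<forall>Y\<in>vector_fields atlas. \<forall>Z\<in>vector_fields atlas.
    curvature D X Y Z =
      F \<odot> R1 g X Y Z + (F - \<kappa>) \<odot> R3 g \<xi> \<eta> X Y Z +
      \<mu> \<odot> R4 g \<phi> \<xi> X Y Z + \<nu> \<odot> R7 g \<phi> \<xi> X Y Z"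
proof -
  interpret kmn_contact_metric_manifold atlas g \<phi> \<xi> \<eta> D \<kappa> \<mu> \<nu> by (rule assms(1))
  show ?thesis
    unfolding assms(4) using curvature_decomposition[OF assms(2)] by blast
qed

end
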